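(* Let $1\le n\le N$ and let the previous levels $u^{n-1},\dots,u^{\max(n-3,0)}\in V$ be given. If the time-step size satisfies $$\tau_n<\frac{1+2 r_n+r_{n-1}\left(1+4 r_n+3 r_n^2\right)}{(1+r_n)(1+r_{n-1}+r_nr_{n-1})},$$ then the variable-step BDF3 scheme $$D_3u^n-\varepsilon^2\Delta u^n+f(u^n)=0$$ is uniquely solvable at level $n$, i.e. there is exactly one $u^n\in V$ satisfying it.
   Context: Let $0=t_0<t_1<\dots<t_N=T$, $\tau_k=t_k-t_{k-1}$ for $1\le k\le N$, $r_k=\tau_k/\tau_{k-1}$ for $k\ge 2$, and use the convention $r_1=r_0=0$ in the displayed step-size condition when $n=1,2$. For a sequence $(v^n)_{n=0}^N$ put $\nabla_\tau v^n=v^n-v^{n-1}$. The variable-step BDF3 operator is $D_3v^n=\sum_{k=1}^n b_{n-k}^{(n)}\nabla_\tau v^k$, where $b_0^{(1)}=1/\tau_1$, $b_0^{(2)}=\frac{1+2r_2}{\tau_2(1+r_2)}$, $b_1^{(2)}=-\frac{r_2^2}{\tau_2(1+r_2)}$ (BDF1 and BDF2 starting steps), and for $n\ge 3$ $$b_0^{(n)}=\frac{(1+r_{n-1})\left[1+2 r_n+r_{n-1}(1+4 r_n+3 r_n^2)\right]}{\tau_n(1+r_n)(1+r_{n-1})(1+r_{n-1}+r_nr_{n-1})},$$ $$b_1^{(n)}=-\frac{r_n^2\left[(1+2r_{n-1}+r_nr_{n-1})^2-r_{n-1}(1+r_{n-1})\right]}{\tau_n(1+r_n)(1+r_{n-1})(1+r_{n-1}+r_nr_{n-1})},$$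 $$b_2^{(n)}=\frac{r_n^2r_{n-1}^3(1+r_n)^2}{\tau_n(1+r_n)(1+r_{n-1})(1+r_{n-1}+r_nr_{n-1})},\qquad b_j^{(n)}=0\ (j\ge 3).$$ The scheme discretizes the Allen-Cahn equation $\partial_tu-\varepsilon^2\Delta u+f(u)=0$ with $\varepsilon>0$, $f(u)=u^3-u$, on a bounded periodic cell $\Omega\subset\mathbb{R}^d$ with periodic boundary conditions. Let $V$ be the space of periodic functions in $H^1(\Omega)\cap L^4(\Omega)$; the scheme is understood weakly: $(D_3u^n,v)+\varepsilon^2(\nabla u^n,\nabla v)+(f(u^n),v)=0$ for all $v\in V$, where $(\cdot,\cdot)$ is the $L^2(\Omega)$ inner product. *)

theory Defs
  imports "HOL-Analysis.Analysis"
begin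

section \<open>Time mesh and the variable-step BDF3 operator\<close>

definition time_mesh :: "nat \<Rightarrow> real \<Rightarrow> (nat \<Rightarrow> real) \<Rightarrow> bool" where
  "time_mesh N T t \<longleftrightarrow> t 0 = 0 \<and> t N = T \<and> (\<forall>k<N. t k < t (Suc k))"

definition step :: "(nat \<Rightarrow> real) \<Rightarrow> nat \<Rightarrow> real" where
  "step t k = t k - t (k - 1)"

text \<open>The ratio is set to 0 for the indices 0 and 1, where no previous step exists.\<close>

definition ratio :: "(nat \<Rightarrow> real) \<Rightarrow> nat \<Rightarrow> real" where
  "ratio t k = (if k \<ge> 2 then step t k / step t (k - 1) else 0)"

text \<open>\<open>bdf3_coeff t n j\<close> is the coefficient of level \<open>n\<close> with lower index \<open>j\<close>; levels 1 and 2 are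
  the BDF1 and BDF2 starting steps. Only \<open>n \<ge> 1\<close> is meaningful.\<close>

definition bdf3_coeff :: "(nat \<Rightarrow> real) \<Rightarrow> nat \<Rightarrow> nat \<Rightarrow> real" where
  "bdf3_coeff t n j =
    (let \<tau> = step t n; r = ratio t n; s = ratio t (n - 1);
         den = \<tau> * (1 + r) * (1 + s) * (1 + s + r * s)
     in if n = 1 then (if j = 0 then 1 / \<tau> else 0)
        else if n = 2 then
          (if j = 0 then (1 + 2 * r) / (\<tau> * (1 + r))
           else if j = 1 then - (r\<^sup>2 / (\<tau> * (1 + r)))
           else 0)
        else
          (if j = 0 then (1 + s) * (1 + 2 * r + s * (1 + 4 * r + 3 * r\<^sup>2)) / den
           else if j = 1 then - (r\<^sup>2 * ((1 + 2 * s + r * s)\<^sup>2 - s * (1 + s)) / den)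
           else if j = 2 then r\<^sup>2 * s ^ 3 * (1 + r)\<^sup>2 / den
           else 0))"

definition D3 :: "(nat \<Rightarrow> real) \<Rightarrow> nat \<Rightarrow> (nat \<Rightarrow> 'a \<Rightarrow> real) \<Rightarrow> 'a \<Rightarrow> real" where
  "D3 t n v x = (\<Sum>k=1..n. bdf3_coeff t n (n - k) * (v k x - v (k - 1) x))"

section \<open>Periodic cell and periodic functions\<close>

text \<open>A family \<open>p\<close> of linearly independent period vectors spans a period lattice; the cell is the open
  parallelepiped on these vectors. The rectangular box with side lengths \<open>L\<close> is the
  case \<open>p i = axis i (L i)\<close>.\<close>

definition period_basis :: "('d::finite \<Rightarrow> real ^ 'd) \<Rightarrow> bool" where
  "period_basis p \<longleftrightarrow> inj p \<and> independent (range p)"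

definition cell :: "('d::finite \<Rightarrow> real ^ 'd) \<Rightarrow> (real ^ 'd) set" where
  "cell p = {\<Sum>i\<in>UNIV. s i *\<^sub>R p i | s. \<forall>i. 0 < s i \<and> s i < 1}"

definition periodic :: "('d::finite \<Rightarrow> real ^ 'd) \<Rightarrow> (real ^ 'd \<Rightarrow> 'b) \<Rightarrow> bool" where
  "periodic p u \<longleftrightarrow> (\<forall>x i. u (x + p i) = u x)"

section \<open>The function space\<close>

definition in_Lp :: "nat \<Rightarrow> ('a::euclidean_space) set \<Rightarrow> ('a \<Rightarrow> 'b::euclidean_space) \<Rightarrow> bool" where
  "in_Lp q S u \<longleftrightarrow> u \<in> borel_measurable (lebesgue_on S) \<and>
     integrable (lebesgue_on S) (\<lambda>x. norm (u x) ^ q)"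

definition L2_inner ::
  "('a::euclidean_space) set \<Rightarrow> ('a \<Rightarrow> 'b::euclidean_space) \<Rightarrow> ('a \<Rightarrow> 'b) \<Rightarrow> real" where
  "L2_inner S u v = (\<integral>x. u x \<bullet> v x \<partial>lebesgue_on S)"

primrec C_k :: "nat \<Rightarrow> (real ^ 'd::finite \<Rightarrow> real) \<Rightarrow> bool" where
  "C_k 0 f \<longleftrightarrow> continuous_on UNIV f"
| "C_k (Suc k) f \<longleftrightarrow> (\<exists>D. (\<forall>x. GDERIV f x :> D x) \<and> (\<forall>i. C_k k (\<lambda>x. D x $ i)))"

definition smooth :: "(real ^ 'd::finite \<Rightarrow> real) \<Rightarrow> bool" where
  "smooth f \<longleftrightarrow> (\<forall>k. C_k k f)"

text \<open>Weak gradients on the torus: for a periodic \<open>u\<close>, integration by parts over one cell against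
  smooth periodic functions has no boundary term. Tests that do not vanish near the boundary
  of the cell are what rules out jumps across opposite faces, so that the periodic extension is
  locally in the Sobolev space. The gradient \<open>G\<close> is determined almost everywhere on the cell.\<close>

definition has_weak_gradient ::
  "('d::finite \<Rightarrow> real ^ 'd) \<Rightarrow> (real ^ 'd \<Rightarrow> real) \<Rightarrow> (real ^ 'd \<Rightarrow> real ^ 'd) \<Rightarrow> bool" where
  "has_weak_gradient p u G \<longleftrightarrow> in_Lp 2 (cell p) G \<and>
     (\<forall>\<phi> D. smooth \<phi> \<and> periodic p \<phi> \<and> (\<forall>x. GDERIV \<phi> x :> D x) \<longrightarrow>
       (\<integral>x. u x *\<^sub>R D x \<partial>lebesgue_on (cell p)) = - (\<integral>x. \<phi> x *\<^sub>R G x \<partial>lebesgue_on (cell p)))"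

text \<open>Elements are representatives; two of them are the same element of the space iff they agree
  almost everywhere on the cell.\<close>

definition V_space :: "('d::finite \<Rightarrow> real ^ 'd) \<Rightarrow> (real ^ 'd \<Rightarrow> real) set" where
  "V_space p = {u. periodic p u \<and> in_Lp 2 (cell p) u \<and> in_Lp 4 (cell p) u \<and>
     (\<exists>G. has_weak_gradient p u G)}"

definition ae_eq_on :: "('a::euclidean_space) set \<Rightarrow> ('a \<Rightarrow> 'b) \<Rightarrow> ('a \<Rightarrow> 'b) \<Rightarrow> bool" where
  "ae_eq_on S u v \<longleftrightarrow> (AE x in lebesgue_on S. u x = v x)"

section \<open>The scheme\<close>

definition ac_nonlinearity :: "real \<Rightarrow> real" where
  "ac_nonlinearity z = z ^ 3 - z"

definition bdf3_scheme_at ::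
  "('d::finite \<Rightarrow> real ^ 'd) \<Rightarrow> real \<Rightarrow> (nat \<Rightarrow> real) \<Rightarrow> nat \<Rightarrow> (nat \<Rightarrow> real ^ 'd \<Rightarrow> real) \<Rightarrow> bool" where
  "bdf3_scheme_at p \<epsilon> t n u \<longleftrightarrow>
     (\<exists>G. has_weak_gradient p (u n) G \<and>
       (\<forall>v\<in>V_space p. \<forall>H. has_weak_gradient p v H \<longrightarrow>
          L2_inner (cell p) (D3 t n u) v + \<epsilon>\<^sup>2 * L2_inner (cell p) G H
            + L2_inner (cell p) (\<lambda>x. ac_nonlinearity (u n x)) v = 0))"

end

theory Submission
  imports Defs
begin

text \<open>
  At level \<open>n\<close> the operator splits as \<open>D3 u\<^sup>n = b u\<^sup>n - g\<close>, where \<open>b\<close> is the leading coefficient and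
  \<open>g\<close> collects the known levels. The step-size condition says exactly that \<open>a = b - 1\<close> is positive, so the
  concave part \<open>- u\<^sup>n\<close> of the nonlinearity is absorbed and the scheme reads
  \<open>a w + w\<^sup>3 - \<epsilon>\<^sup>2 \<Delta>w = g\<close>. This is the Euler-Lagrange equation of the energy
  \<open>E(w) = \<integral> a/2 w\<^sup>2 + 1/4 w\<^sup>4 + \<epsilon>\<^sup>2/2 |\<nabla>w|\<^sup>2 - g w\<close>, which is strictly convex.

  Existence: the energy is bounded below, and it exceeds linear interpolation at midpoints by a fixed multiple
  of the squared distance in \<open>H\<^sup>1\<close> (lemma \<open>energy_density_midpoint\<close>). Hence a minimising sequence
  is Cauchy in \<open>H\<^sup>1\<close>, and strong convergence takes the place of weak compactness. By completeness of
  \<open>L\<^sup>2\<close> (lemma \<open>L2_complete\<close>) a subsequence of functions and gradients converges in norm and almost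
  everywhere. Fatou's lemma, applied to the energy density shifted to be nonnegative, gives both the fourth-power
  integrability of the limit and its minimality. The energy along a line is a polynomial of degree four in the
  parameter, so its derivative at the minimum vanishes, which is the weak form of the scheme
  (lemma \<open>energy_critical_point\<close>).

  Uniqueness: subtracting the equations of two solutions and testing with their difference leaves a sum of
  nonnegative integrals, one of which is \<open>a\<close> times the squared \<open>L\<^sup>2\<close> distance
  (lemma \<open>critical_point_unique\<close>).

  Functions are carried together with a weak gradient as pairs \<open>(w, G)\<close>, so that one convergence statement
  for \<open>\<real> \<times> \<real>\<^sup>d\<close>-valued functions covers both components.
\<close>

section \<open>Square-integrable functions on a finite measure space\<close>

text \<open>Fatou's lemma for real integrals. It also delivers integrability of the limit, and that is how the
  limit of a minimising sequence is seen to be in \<open>L\<^sup>4\<close>.\<close>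

lemma integral_le_of_limit:
  fixes f :: "nat \<Rightarrow> 'a \<Rightarrow> real"
  assumes F: "F \<in> borel_measurable M"
    and f: "\<And>k. integrable M (f k)"
    and nonneg: "\<And>k x. 0 \<le> f k x"
    and lim: "AE x in M. (\<lambda>k. f k x) \<longlonglongrightarrow> F x"
    and bound: "\<And>k. (\<integral>x. f k x \<partial>M) \<le> c k"
    and c: "c \<longlonglongrightarrow> C"
  shows "integrable M F" and "(\<integral>x. F x \<partial>M) \<le> C"
proof -
  have F0: "AE x in M. 0 \<le> F x"
    using lim by eventually_elim (rule LIMSEQ_le_const, auto simp: nonneg)
  have c0: "0 \<le> c k" for k
    by (rule order_trans[OF _ bound]) (simp add: nonneg)
  have C0: "0 \<le> C"
    by (rule LIMSEQ_le_const[OF c]) (auto simp: c0)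
  have "(\<integral>\<^sup>+x. ennreal (F x) \<partial>M) = (\<integral>\<^sup>+x. liminf (\<lambda>k. ennreal (f k x)) \<partial>M)"
  proof (rule nn_integral_cong_AE)
    show "AE x in M. ennreal (F x) = liminf (\<lambda>k. ennreal (f k x))"
      using lim
    proof eventually_elim
      case (elim x)
      then show ?case
        using lim_imp_Liminf[of sequentially "\<lambda>k. ennreal (f k x)" "ennreal (F x)"]
        by (simp add: tendsto_ennrealI)
    qed
  qed
  also have "\<dots> \<le> liminf (\<lambda>k. \<integral>\<^sup>+x. ennreal (f k x) \<partial>M)"
    using f by (intro nn_integral_liminf) auto
  also have "\<dots> \<le> liminf (\<lambda>k. ennreal (c k))"
    by (intro Liminf_mono always_eventually allI)
      (simp add: nn_integral_eq_integral[OF f] nonneg bound ennreal_leI)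
  also have "\<dots> = ennreal C"
    using lim_imp_Liminf[of sequentially "\<lambda>k. ennreal (c k)" "ennreal C"] c
    by (simp add: tendsto_ennrealI)
  finally have le: "(\<integral>\<^sup>+x. ennreal (F x) \<partial>M) \<le> ennreal C" .
  show int: "integrable M F"
    by (rule integrableI_nonneg[OF F F0]) (use le in \<open>auto intro: le_less_trans\<close>)
  show "(\<integral>x. F x \<partial>M) \<le> C"
    using le by (simp add: nn_integral_eq_integral[OF int F0] C0)
qed

definition square_integrable :: "'a measure \<Rightarrow> ('a \<Rightarrow> 'b::euclidean_space) \<Rightarrow> bool" where
  "square_integrable M f \<longleftrightarrow> f \<in> borel_measurable M \<and> integrable M (\<lambda>x. (norm (f x))\<^sup>2)"

lemma square_integrable_measurable [measurable_dest]:
  "square_integrable M f \<Longrightarrow> f \<in> borel_measurable M"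
  by (simp add: square_integrable_def)

lemma square_integrable_norm:
  "square_integrable M f \<Longrightarrow> integrable M (\<lambda>x. (norm (f x))\<^sup>2)"
  by (simp add: square_integrable_def)

lemma two_norm_mult_le: "2 * (norm a * norm b) \<le> (norm a)\<^sup>2 + (norm b)\<^sup>2"
  using sum_squares_bound[of "norm a" "norm b"] by simp

lemma square_integrable_add:
  assumes "square_integrable M f" "square_integrable M g"
  shows "square_integrable M (\<lambda>x. f x + g x)"
  unfolding square_integrable_def
proof
  show [measurable]: "(\<lambda>x. f x + g x) \<in> borel_measurable M"
    using assms by measurable
  have "(norm (f x + g x))\<^sup>2 \<le> 2 * (norm (f x))\<^sup>2 + 2 * (norm (g x))\<^sup>2" for x
  proof -
    have "(norm (f x + g x))\<^sup>2 \<le> (norm (f x) + norm (g x))\<^sup>2"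
      by (intro power_mono norm_triangle_ineq) auto
    then show ?thesis
      using two_norm_mult_le[of "f x" "g x"] by (simp add: power2_sum)
  qed
  then have le: "norm ((norm (f x + g x))\<^sup>2) \<le> norm (2 * (norm (f x))\<^sup>2 + 2 * (norm (g x))\<^sup>2)" for x
    by simp
  have "integrable M (\<lambda>x. 2 * (norm (f x))\<^sup>2 + 2 * (norm (g x))\<^sup>2)"
    by (simp add: assms square_integrable_norm)
  then show "integrable M (\<lambda>x. (norm (f x + g x))\<^sup>2)"
    by (rule Bochner_Integration.integrable_bound) (measurable, rule AE_I2, rule le)
qed

lemma square_integrable_scaleR:
  "square_integrable M f \<Longrightarrow> square_integrable M (\<lambda>x. c *\<^sub>R f x)"
  by (auto simp: square_integrable_def power_mult_distrib)

lemma square_integrable_diff: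
  assumes "square_integrable M f" "square_integrable M g"
  shows "square_integrable M (\<lambda>x. f x - g x)"
  using square_integrable_add[OF assms(1) square_integrable_scaleR[OF assms(2), of "-1"]] by simp

lemma square_integrable_inner:
  assumes "square_integrable M f" "square_integrable M g"
  shows "integrable M (\<lambda>x. f x \<bullet> g x)"
proof (rule Bochner_Integration.integrable_bound)
  show "integrable M (\<lambda>x. (norm (f x))\<^sup>2 + (norm (g x))\<^sup>2)"
    by (simp add: assms square_integrable_norm)
  show "(\<lambda>x. f x \<bullet> g x) \<in> borel_measurable M"
    using assms by measurable
  have "norm (f x \<bullet> g x) \<le> norm ((norm (f x))\<^sup>2 + (norm (g x))\<^sup>2)" for x
    using Cauchy_Schwarz_ineq2[of "f x" "g x"] two_norm_mult_le[of "f x" "g x"]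
      mult_nonneg_nonneg[OF norm_ge_zero[of "f x"] norm_ge_zero[of "g x"]] by simp
  then show "AE x in M. norm (f x \<bullet> g x) \<le> norm ((norm (f x))\<^sup>2 + (norm (g x))\<^sup>2)"
    by simp
qed

text \<open>Young's inequality with a free weight. After integration over a finite measure it bounds the
  \<open>L\<^sup>1\<close> norm by the \<open>L\<^sup>2\<close> norm, a suitable \<open>\<delta>\<close> playing the part of the
  Cauchy-Schwarz inequality.\<close>

lemma norm_le_weighted_square:
  assumes "0 < \<delta>"
  shows "norm a \<le> \<delta> + (norm a)\<^sup>2 / \<delta>"
proof -
  have "\<delta> * norm a \<le> \<delta>\<^sup>2 + (norm a)\<^sup>2"
    using sum_squares_bound[of \<delta> "norm a"] assms
      mult_nonneg_nonneg[of \<delta> "norm a"] norm_ge_zero[of a] by linarith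
  then show ?thesis
    using assms by (simp add: field_simps power2_eq_square)
qed

context finite_measure
begin

lemma square_integrable_integrable:
  assumes "square_integrable M f"
  shows "integrable M f"
proof (rule Bochner_Integration.integrable_bound)
  show "integrable M (\<lambda>x. 1 + (norm (f x))\<^sup>2)"
    by (simp add: assms square_integrable_norm)
  show "f \<in> borel_measurable M"
    using assms by measurable
  show "AE x in M. norm (f x) \<le> norm (1 + (norm (f x))\<^sup>2)"
    by (rule AE_I2) (use norm_le_weighted_square[of 1] in simp)
qed

lemma integral_norm_le_weighted:
  assumes "square_integrable M f" "0 < \<delta>"
  shows "(\<integral>x. norm (f x) \<partial>M) \<le> \<delta> * Sigma_Algebra.measure M (space M) + (\<integral>x. (norm (f x))\<^sup>2 \<partial>M) / \<delta>"
proof -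
  have "(\<integral>x. norm (f x) \<partial>M) \<le> (\<integral>x. \<delta> + (norm (f x))\<^sup>2 / \<delta> \<partial>M)"
    using assms
    by (intro integral_mono norm_le_weighted_square)
      (auto simp: square_integrable_norm intro!: square_integrable_integrable integrable_norm)
  also have "\<dots> = \<delta> * Sigma_Algebra.measure M (space M) + (\<integral>x. (norm (f x))\<^sup>2 \<partial>M) / \<delta>"
    using assms by (subst Bochner_Integration.integral_add) (auto simp: square_integrable_norm)
  finally show ?thesis .
qed

lemma L1_limit_of_L2_limit:
  fixes f :: "nat \<Rightarrow> 'a \<Rightarrow> 'b::euclidean_space"
  assumes f: "\<And>k. square_integrable M (f k)"
    and lim: "(\<lambda>k. \<integral>x. (norm (f k x))\<^sup>2 \<partial>M) \<longlonglongrightarrow> 0"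
  shows "(\<lambda>k. \<integral>x. norm (f k x) \<partial>M) \<longlonglongrightarrow> 0"
proof (rule LIMSEQ_I)
  fix r :: real assume r: "0 < r"
  define \<delta> where "\<delta> = r / (2 * (Sigma_Algebra.measure M (space M) + 1))"
  have \<delta>: "0 < \<delta>" using r by (simp add: \<delta>_def add_nonneg_pos)
  have \<delta>m: "\<delta> * Sigma_Algebra.measure M (space M) \<le> r / 2"
  proof -
    have "\<delta> * Sigma_Algebra.measure M (space M) \<le> \<delta> * (Sigma_Algebra.measure M (space M) + 1)"
      using \<delta> by (intro mult_left_mono) auto
    also have "\<dots> = r / 2"
      unfolding \<delta>_def using measure_nonneg[of M "space M"] by (simp add: field_simps add_nonneg_eq_0_iff)
    finally show ?thesis .
  qed
  obtain N where N: "\<And>k. k \<ge> N \<Longrightarrow> norm ((\<integral>x. (norm (f k x))\<^sup>2 \<partial>M) - 0) < \<delta> * (r / 2)"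
    using LIMSEQ_D[OF lim, of "\<delta> * (r / 2)"] \<delta> r by auto
  show "\<exists>no. \<forall>k\<ge>no. norm ((\<integral>x. norm (f k x) \<partial>M) - 0) < r"
  proof (intro exI allI impI)
    fix k assume "N \<le> k"
    then have "(\<integral>x. (norm (f k x))\<^sup>2 \<partial>M) < \<delta> * (r / 2)"
      using N[of k] by simp
    then have "(\<integral>x. (norm (f k x))\<^sup>2 \<partial>M) / \<delta> < r / 2"
      using \<delta> by (simp add: pos_divide_less_eq mult.commute)
    then have "(\<integral>x. norm (f k x) \<partial>M) < r"
      using integral_norm_le_weighted[OF f[of k] \<delta>] \<delta>m by linarith
    then show "norm ((\<integral>x. norm (f k x) \<partial>M) - 0) < r"
      by simp
  qed
qed

text \<open>The Riesz-Fischer argument: along a subsequence with squared distances at most \<open>4\<^sup>-\<^sup>k\<close> the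
  increments are summable in \<open>L\<^sup>1\<close>, hence summable at almost every point, and Fatou's lemma
  turns the pointwise limit into a limit in norm. The almost everywhere convergence is part of the conclusion,
  since the quartic term of the energy and the periodicity of the limit depend on it.\<close>

lemma L2_complete:
  fixes f :: "nat \<Rightarrow> 'a \<Rightarrow> 'b::euclidean_space"
  assumes f: "\<And>k. square_integrable M (f k)"
    and Cauchy: "\<And>e. 0 < e \<Longrightarrow> \<exists>N. \<forall>i\<ge>N. \<forall>j\<ge>N. (\<integral>x. (norm (f i x - f j x))\<^sup>2 \<partial>M) \<le> e"
  obtains r F where "strict_mono r"
    and "AE x in M. (\<lambda>k. f (r k) x) \<longlonglongrightarrow> F x"
    and "square_integrable M F"
    and "(\<lambda>k. \<integral>x. (norm (f (r k) x - F x))\<^sup>2 \<partial>M) \<longlonglongrightarrow> 0"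
proof -
  note [measurable] = f[THEN square_integrable_measurable]
  have "\<exists>N. \<forall>i\<ge>N. \<forall>j\<ge>N. (\<integral>x. (norm (f i x - f j x))\<^sup>2 \<partial>M) \<le> (1/4) ^ n" for n :: nat
    by (rule Cauchy) simp
  then have "\<exists>R. \<forall>n. \<forall>i\<ge>R n. \<forall>j\<ge>R n. (\<integral>x. (norm (f i x - f j x))\<^sup>2 \<partial>M) \<le> (1/4) ^ n"
    by (intro choice allI)
  then obtain R where "\<forall>n. \<forall>i\<ge>R n. \<forall>j\<ge>R n. (\<integral>x. (norm (f i x - f j x))\<^sup>2 \<partial>M) \<le> (1/4) ^ n"
    by (rule exE)
  then have R: "(\<integral>x. (norm (f i x - f j x))\<^sup>2 \<partial>M) \<le> (1/4) ^ n" if "R n \<le> i" "R n \<le> j" for n i j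
    using that by simp
  \<comment> \<open>The partial sums of \<open>R i + 1\<close> are strictly increasing and dominate \<open>R\<close>.\<close>
  define r where "r n = (\<Sum>i\<le>n. R i + 1)" for n
  have r: "strict_mono r"
    by (rule strict_monoI_Suc) (simp add: r_def)
  have Rr: "R n \<le> r m" if "n \<le> m" for n m
  proof -
    have "R n \<le> R n + 1" by simp
    also have "\<dots> \<le> r n" unfolding r_def by (rule member_le_sum) auto
    also have "\<dots> \<le> r m" using r that by (simp add: strict_mono_less_eq)
    finally show ?thesis .
  qed
  have close: "(\<integral>x. (norm (f (r i) x - f (r j) x))\<^sup>2 \<partial>M) \<le> (1/4) ^ n" if "n \<le> i" "n \<le> j" for n i j
    using R Rr that by blast
  \<comment> \<open>The weight \<open>2\<^sup>-\<^sup>k\<close> balances the two terms of Young's inequality for the increment \<open>d k\<close>.\<close>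
  define d where "d k x = f (r (Suc k)) x - f (r k) x" for k x
  have d: "square_integrable M (d k)" for k
    unfolding d_def using f by (intro square_integrable_diff)
  have d_int: "(\<integral>x. norm (d k x) \<partial>M) \<le> (1/2) ^ k * (Sigma_Algebra.measure M (space M) + 1)" for k
  proof -
    have "(\<integral>x. norm (d k x) \<partial>M) \<le> (1/2) ^ k * Sigma_Algebra.measure M (space M) + (\<integral>x. (norm (d k x))\<^sup>2 \<partial>M) / (1/2) ^ k"
      by (rule integral_norm_le_weighted[OF d]) simp
    also have "\<dots> \<le> (1/2) ^ k * Sigma_Algebra.measure M (space M) + (1/4) ^ k / (1/2) ^ k"
      using close[of k "Suc k" k] unfolding d_def by (intro add_mono divide_right_mono) auto
    also have "(1/4::real) ^ k / (1/2) ^ k = (1/2) ^ k"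
      by (simp add: power_divide[symmetric])
    finally show ?thesis by (simp add: algebra_simps)
  qed
  have summable_d: "AE x in M. summable (\<lambda>k. norm (d k x))"
  proof -
    have [measurable]: "d k \<in> borel_measurable M" for k
      using d by (rule square_integrable_measurable)
    have "(\<integral>\<^sup>+x. (\<Sum>k. ennreal (norm (d k x))) \<partial>M) = (\<Sum>k. \<integral>\<^sup>+x. ennreal (norm (d k x)) \<partial>M)"
      by (rule nn_integral_suminf) measurable
    also have "\<dots> \<le> (\<Sum>k. ennreal ((1/2) ^ k * (Sigma_Algebra.measure M (space M) + 1)))"
      using d_int
      by (intro suminf_le summableI)
        (simp add: nn_integral_eq_integral square_integrable_integrable[OF d] ennreal_leI)
    also have "\<dots> < \<infinity>"
    proof -
      have "summable (\<lambda>k. (1/2) ^ k * (Sigma_Algebra.measure M (space M) + 1) :: real)"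
        by (intro summable_mult2 summable_geometric) simp
      then show ?thesis
        by (subst suminf_ennreal2) auto
    qed
    finally have "AE x in M. (\<Sum>k. ennreal (norm (d k x))) \<noteq> \<infinity>"
      by (intro nn_integral_PInf_AE) auto
    then show ?thesis
      by eventually_elim (intro summable_suminf_not_top, auto)
  qed
  define F where "F x = lim (\<lambda>k. f (r k) x)" for x
  have F_meas [measurable]: "F \<in> borel_measurable M"
    unfolding F_def by measurable
  have conv: "AE x in M. (\<lambda>k. f (r k) x) \<longlonglongrightarrow> F x"
    using summable_d
  proof eventually_elim
    case (elim x)
    have "convergent (\<lambda>n. \<Sum>k<n. d k x)"
      using summable_norm_cancel[OF elim] by (simp add: summable_iff_convergent)
    moreover have "(\<Sum>k<n. d k x) = f (r n) x - f (r 0) x" for n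
      unfolding d_def by (rule sum_lessThan_telescope)
    ultimately have "convergent (\<lambda>n. f (r n) x - f (r 0) x)" by simp
    then have "convergent (\<lambda>n. f (r n) x)"
      using convergent_diff_const_right_iff by blast
    then show ?case unfolding F_def by (simp add: convergent_LIMSEQ_iff)
  qed
  have tail: "integrable M (\<lambda>x. (norm (f (r k) x - F x))\<^sup>2)"
    "(\<integral>x. (norm (f (r k) x - F x))\<^sup>2 \<partial>M) \<le> (1/4) ^ k" for k
  proof -
    have a: "integrable M (\<lambda>x. (norm (f (r k) x - f (r (j + k)) x))\<^sup>2)" for j
      using f by (intro square_integrable_norm square_integrable_diff)
    have b: "AE x in M. (\<lambda>j. (norm (f (r k) x - f (r (j + k)) x))\<^sup>2) \<longlonglongrightarrow> (norm (f (r k) x - F x))\<^sup>2"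
      using conv by eventually_elim (intro tendsto_intros LIMSEQ_ignore_initial_segment)
    have c: "(\<integral>x. (norm (f (r k) x - f (r (j + k)) x))\<^sup>2 \<partial>M) \<le> (1/4) ^ k" for j
      by (rule close) auto
    have m: "(\<lambda>x. (norm (f (r k) x - F x))\<^sup>2) \<in> borel_measurable M"
      by measurable
    show "integrable M (\<lambda>x. (norm (f (r k) x - F x))\<^sup>2)"
      "(\<integral>x. (norm (f (r k) x - F x))\<^sup>2 \<partial>M) \<le> (1/4) ^ k"
      using integral_le_of_limit[OF m a _ b c tendsto_const] by auto
  qed
  have "square_integrable M (\<lambda>x. f (r 0) x - F x)"
    unfolding square_integrable_def using tail(1)[of 0] by auto
  from square_integrable_diff[OF f[of "r 0"] this] have F: "square_integrable M F"
    by simp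
  have "(\<lambda>k. \<integral>x. (norm (f (r k) x - F x))\<^sup>2 \<partial>M) \<longlonglongrightarrow> 0"
    by (rule tendsto_sandwich[OF _ _ tendsto_const LIMSEQ_realpow_zero[of "1/4"]])
      (auto simp: tail(2))
  with r conv F show ?thesis by (rule that)
qed

end

section \<open>The energy density and its convexity\<close>

text \<open>The first component of a pair stands for a function and the second for its gradient.\<close>

definition finite_energy :: "'a measure \<Rightarrow> ('a \<Rightarrow> real \<times> 'b::euclidean_space) \<Rightarrow> bool" where
  "finite_energy M f \<longleftrightarrow> square_integrable M f \<and> integrable M (\<lambda>x. fst (f x) ^ 4)"

definition energy_density :: "real \<Rightarrow> real \<Rightarrow> real \<Rightarrow> real \<times> 'b::real_inner \<Rightarrow> real" where
  "energy_density a e c z =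
     a / 2 * (fst z)\<^sup>2 + fst z ^ 4 / 4 + e / 2 * (norm (snd z))\<^sup>2 - c * fst z"

lemma square_integrable_Pair:
  "square_integrable M (\<lambda>x. (u x, G x)) \<longleftrightarrow> square_integrable M u \<and> square_integrable M G"
proof
  assume *: "square_integrable M u \<and> square_integrable M G"
  then have [measurable]: "u \<in> borel_measurable M" "G \<in> borel_measurable M"
    by (auto simp: square_integrable_def)
  show "square_integrable M (\<lambda>x. (u x, G x))"
    using * by (auto simp: square_integrable_def norm_Pair)
next
  assume *: "square_integrable M (\<lambda>x. (u x, G x))"
  then have P [measurable]: "(\<lambda>x. (u x, G x)) \<in> borel_measurable M"
    and int: "integrable M (\<lambda>x. (norm (u x))\<^sup>2 + (norm (G x))\<^sup>2)"
    by (auto simp: square_integrable_def norm_Pair)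
  have u [measurable]: "u \<in> borel_measurable M"
    using measurable_compose[OF P, of fst borel] by (simp add: borel_measurable_continuous_onI continuous_on_fst)
  have G [measurable]: "G \<in> borel_measurable M"
    using measurable_compose[OF P, of snd borel] by (simp add: borel_measurable_continuous_onI continuous_on_snd)
  have "integrable M (\<lambda>x. (norm (u x))\<^sup>2)" "integrable M (\<lambda>x. (norm (G x))\<^sup>2)"
    by (rule Bochner_Integration.integrable_bound[OF int]; simp)+
  then show "square_integrable M u \<and> square_integrable M G"
    by (simp add: square_integrable_def u G)
qed

lemma square_integrable_fst:
  fixes f :: "'a \<Rightarrow> real \<times> 'b::euclidean_space"
  shows "square_integrable M f \<Longrightarrow> square_integrable M (\<lambda>x. fst (f x))"
  using square_integrable_Pair[of M "\<lambda>x. fst (f x)" "\<lambda>x. snd (f x)"] by simp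

lemma square_integrable_snd:
  fixes f :: "'a \<Rightarrow> real \<times> 'b::euclidean_space"
  shows "square_integrable M f \<Longrightarrow> square_integrable M (\<lambda>x. snd (f x))"
  using square_integrable_Pair[of M "\<lambda>x. fst (f x)" "\<lambda>x. snd (f x)"] by simp

text \<open>Every quartic monomial is dominated by the fourth power of the larger factor. All mixed terms of the
  energy along a line are integrable by this bound.\<close>

lemma abs_quartic_monomial_le:
  fixes w v :: real
  assumes "i + j = 4"
  shows "\<bar>w ^ i * v ^ j\<bar> \<le> w ^ 4 + v ^ 4"
proof -
  define m where "m = max \<bar>w\<bar> \<bar>v\<bar>"
  have "\<bar>w ^ i * v ^ j\<bar> \<le> m ^ i * m ^ j"
    unfolding abs_mult power_abs by (intro mult_mono power_mono) (auto simp: m_def)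
  also have "\<dots> = m ^ 4"
    by (simp add: assms flip: power_add)
  also have "\<dots> \<le> w ^ 4 + v ^ 4"
    by (auto simp: m_def max_def)
  finally show ?thesis .
qed

lemma integrable_quartic_monomial:
  fixes w v :: "'a \<Rightarrow> real"
  assumes [measurable]: "w \<in> borel_measurable M" "v \<in> borel_measurable M"
    and int: "integrable M (\<lambda>x. w x ^ 4)" "integrable M (\<lambda>x. v x ^ 4)"
    and "i + j = 4"
  shows "integrable M (\<lambda>x. w x ^ i * v x ^ j)"
proof (rule Bochner_Integration.integrable_bound)
  show "integrable M (\<lambda>x. w x ^ 4 + v x ^ 4)"
    by (simp add: int)
  have "norm (w x ^ i * v x ^ j) \<le> norm (w x ^ 4 + v x ^ 4)" for x
    using abs_quartic_monomial_le[OF \<open>i + j = 4\<close>, of "w x" "v x"] by simp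
  then show "AE x in M. norm (w x ^ i * v x ^ j) \<le> norm (w x ^ 4 + v x ^ 4)"
    by (rule AE_I2)
qed measurable

lemma integrable_power4_add:
  fixes w v :: "'a \<Rightarrow> real"
  assumes "w \<in> borel_measurable M" "v \<in> borel_measurable M"
    and "integrable M (\<lambda>x. w x ^ 4)" "integrable M (\<lambda>x. v x ^ 4)"
  shows "integrable M (\<lambda>x. (w x + v x) ^ 4)"
proof -
  note q = integrable_quartic_monomial[OF assms]
  have eq: "(w x + v x) ^ 4 = w x ^ 4 * v x ^ 0 + 4 * (w x ^ 3 * v x ^ 1) + 6 * (w x ^ 2 * v x ^ 2)
      + 4 * (w x ^ 1 * v x ^ 3) + w x ^ 0 * v x ^ 4" for x
    by (simp add: power4_eq_xxxx power3_eq_cube power2_eq_square algebra_simps)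
  show ?thesis
    unfolding eq by (intro Bochner_Integration.integrable_add integrable_mult_right q) auto
qed

lemma energy_density_integrable:
  assumes "finite_energy M f" "square_integrable M g"
  shows "integrable M (\<lambda>x. energy_density a e (g x) (f x))"
proof -
  have f: "square_integrable M (\<lambda>x. fst (f x))" "square_integrable M (\<lambda>x. snd (f x))"
    "integrable M (\<lambda>x. fst (f x) ^ 4)"
    using assms by (auto simp: finite_energy_def square_integrable_fst square_integrable_snd)
  show ?thesis
    unfolding energy_density_def
    using f square_integrable_inner[OF assms(2) f(1)] square_integrable_norm[OF f(1)]
      square_integrable_norm[OF f(2)] by simp
qed

text \<open>Completing the square in \<open>a/2 w\<^sup>2 - c w\<close>. The surplus \<open>w\<^sup>4/4\<close> on the left is kept because
  it controls the \<open>L\<^sup>4\<close> norm by the energy.\<close>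

lemma energy_density_lower_bound:
  assumes "0 < a" "0 < e"
  shows "fst z ^ 4 / 4 \<le> energy_density a e c z + c\<^sup>2 / (2 * a)"
proof -
  have "energy_density a e c z + c\<^sup>2 / (2 * a) - fst z ^ 4 / 4
      = a / 2 * (fst z - c / a)\<^sup>2 + e / 2 * (norm (snd z))\<^sup>2"
    using assms by (simp add: energy_density_def field_simps power2_eq_square)
  also have "\<dots> \<ge> 0" using assms by simp
  finally show ?thesis by simp
qed

text \<open>Strong convexity with modulus \<open>min a e\<close>: the two quadratic terms contribute an exact parallelogram identity and
  the quartic term is convex.\<close>

lemma energy_density_midpoint:
  assumes "0 < a" "0 < e"
  shows "energy_density a e c ((1/2) *\<^sub>R (z + z')) + min a e / 8 * (norm (z - z'))\<^sup>2
    \<le> (energy_density a e c z + energy_density a e c z') / 2"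
proof -
  obtain w G v H where z: "z = (w, G)" "z' = (v, H)" by fastforce
  \<comment> \<open>In terms of the mean \<open>p\<close> and the half-difference \<open>d\<close> the quartic defect is visibly nonnegative.\<close>
  define p d where "p = (w + v) / 2" and "d = (w - v) / 2"
  have wv: "w = p + d" "v = p - d" by (simp_all add: p_def d_def field_simps)
  have "(w ^ 4 + v ^ 4) / 2 - ((w + v) / 2) ^ 4 = d\<^sup>2 * (6 * p\<^sup>2 + d\<^sup>2)"
    unfolding wv by (simp add: power4_eq_xxxx power2_eq_square algebra_simps)
  also have "\<dots> \<ge> 0" by simp
  finally have quartic: "((w + v) / 2) ^ 4 \<le> (w ^ 4 + v ^ 4) / 2" by simp
  have square: "((w + v) / 2)\<^sup>2 = (w\<^sup>2 + v\<^sup>2) / 2 - (w - v)\<^sup>2 / 4"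
    by (simp add: power2_eq_square field_simps)
  have norm_square: "(norm ((1/2) *\<^sub>R (G + H)))\<^sup>2 = ((norm G)\<^sup>2 + (norm H)\<^sup>2) / 2 - (norm (G - H))\<^sup>2 / 4"
    by (simp add: power2_norm_eq_inner inner_add_left inner_add_right inner_diff_left
        inner_diff_right inner_commute field_simps)
  have "min a e * ((w - v)\<^sup>2 + (norm (G - H))\<^sup>2) \<le> a * (w - v)\<^sup>2 + e * (norm (G - H))\<^sup>2"
    unfolding distrib_left by (intro add_mono mult_right_mono) auto
  moreover have "(norm (z - z'))\<^sup>2 = (w - v)\<^sup>2 + (norm (G - H))\<^sup>2"
    by (simp add: z norm_Pair)
  moreover have "energy_density a e c ((1/2) *\<^sub>R (z + z'))
      = a / 2 * ((w + v) / 2)\<^sup>2 + ((w + v) / 2) ^ 4 / 4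
        + e / 2 * (norm ((1/2) *\<^sub>R (G + H)))\<^sup>2 - c * ((w + v) / 2)"
    by (simp add: energy_density_def z)
  ultimately show ?thesis
    using quartic unfolding square norm_square by (simp add: energy_density_def z field_simps)
qed

text \<open>The factor of \<open>s\<close> is the integrand of the weak equation with test pair \<open>h\<close>.\<close>

lemma energy_density_expand:
  "energy_density a e c (z + s *\<^sub>R h) = energy_density a e c z
    + s * ((a * fst z + fst z ^ 3 - c) * fst h + e * (snd z \<bullet> snd h))
    + s\<^sup>2 * (a / 2 * (fst h)\<^sup>2 + 3 / 2 * ((fst z)\<^sup>2 * (fst h)\<^sup>2) + e / 2 * (norm (snd h))\<^sup>2)
    + s ^ 3 * (fst z * fst h ^ 3) + s ^ 4 * (fst h ^ 4 / 4)"
proof -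
  have "(norm (snd z + s *\<^sub>R snd h))\<^sup>2
      = (norm (snd z))\<^sup>2 + 2 * s * (snd z \<bullet> snd h) + s\<^sup>2 * (norm (snd h))\<^sup>2"
    unfolding power2_norm_eq_inner
    by (simp add: inner_add_left inner_add_right inner_commute power2_eq_square algebra_simps)
  then show ?thesis
    by (simp add: energy_density_def power4_eq_xxxx power3_eq_cube power2_eq_square field_simps)
qed

lemma linear_term_zero_at_minimum:
  fixes A B C D :: real
  assumes "\<And>s. 0 \<le> s * A + s\<^sup>2 * B + s ^ 3 * C + s ^ 4 * D"
  shows "A = 0"
proof -
  have "((\<lambda>s. s * A + s\<^sup>2 * B + s ^ 3 * C + s ^ 4 * D) has_real_derivative A) (at 0)"
    by (auto intro!: derivative_eq_intros)
  then show ?thesis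
    by (rule DERIV_local_min[OF _ zero_less_one]) (simp add: assms)
qed

lemma energy_variation_integrable:
  assumes f: "finite_energy M f" and h: "finite_energy M h" and g: "square_integrable M g"
  shows "integrable M (\<lambda>x. (a * fst (f x) + fst (f x) ^ 3 - g x) * fst (h x) + e * (snd (f x) \<bullet> snd (h x)))"
proof -
  have sq: "square_integrable M (\<lambda>x. fst (f x))" "square_integrable M (\<lambda>x. fst (h x))"
    "square_integrable M (\<lambda>x. snd (f x))" "square_integrable M (\<lambda>x. snd (h x))"
    using f h by (simp_all add: finite_energy_def square_integrable_fst square_integrable_snd)
  have "integrable M (\<lambda>x. fst (f x) ^ 3 * fst (h x) ^ 1)"
    using sq f h by (intro integrable_quartic_monomial) (auto simp: finite_energy_def square_integrable_def)
  moreover have "(a * fst (f x) + fst (f x) ^ 3 - g x) * fst (h x) + e * (snd (f x) \<bullet> snd (h x))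
      = a * (fst (f x) * fst (h x)) + fst (f x) ^ 3 * fst (h x) ^ 1 - g x * fst (h x)
        + e * (snd (f x) \<bullet> snd (h x))" for x
    by (simp add: algebra_simps)
  ultimately show ?thesis
    using square_integrable_inner[OF sq(1,2)] square_integrable_inner[OF g sq(2)]
      square_integrable_inner[OF sq(3,4)] by simp
qed

text \<open>The difference of the two equations, tested with \<open>f' - f\<close>, is the integral of a nonnegative function
  since the cubic is monotone; therefore that function vanishes almost everywhere, and its first
  term already forces the function components to agree.\<close>

lemma critical_point_unique:
  assumes a: "0 < a" and e: "0 < e" and g: "square_integrable M g"
    and f: "finite_energy M f" and f': "finite_energy M f'" and h: "finite_energy M (\<lambda>x. f' x - f x)"
    and crit: "(\<integral>x. (a * fst (f x) + fst (f x) ^ 3 - g x) * fst (f' x - f x)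
      + e * (snd (f x) \<bullet> snd (f' x - f x)) \<partial>M) = 0"
    and crit': "(\<integral>x. (a * fst (f' x) + fst (f' x) ^ 3 - g x) * fst (f' x - f x)
      + e * (snd (f' x) \<bullet> snd (f' x - f x)) \<partial>M) = 0"
  shows "AE x in M. fst (f' x) = fst (f x)"
proof -
  define I where "I x = a * (fst (f' x) - fst (f x))\<^sup>2
    + (fst (f' x) ^ 3 - fst (f x) ^ 3) * (fst (f' x) - fst (f x)) + e * (norm (snd (f' x) - snd (f x)))\<^sup>2" for x
  have I_eq: "I x = ((a * fst (f' x) + fst (f' x) ^ 3 - g x) * fst (f' x - f x) + e * (snd (f' x) \<bullet> snd (f' x - f x)))
      - ((a * fst (f x) + fst (f x) ^ 3 - g x) * fst (f' x - f x) + e * (snd (f x) \<bullet> snd (f' x - f x)))" for x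
    unfolding I_def power2_norm_eq_inner
    by (simp add: inner_diff_left inner_diff_right inner_commute power2_eq_square algebra_simps)
  have cubic: "0 \<le> (w ^ 3 - v ^ 3) * (w - v)" for w v :: real
  proof -
    have "(w ^ 3 - v ^ 3) * (w - v) = (w - v)\<^sup>2 * ((w + v / 2)\<^sup>2 + 3 / 4 * v\<^sup>2)"
      by (simp add: power2_eq_square power3_eq_cube field_simps)
    then show ?thesis by simp
  qed
  have lower: "a * (fst (f' x) - fst (f x))\<^sup>2 \<le> I x" for x
    unfolding I_def using cubic[of "fst (f' x)" "fst (f x)"] e by simp
  have nonneg: "0 \<le> I x" for x
    by (rule order_trans[OF _ lower]) (use a in simp)
  have int: "integrable M I"
    unfolding I_eq using energy_variation_integrable[OF f' h g] energy_variation_integrable[OF f h g]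
    by (rule Bochner_Integration.integrable_diff)
  have "integral\<^sup>L M I = 0"
    unfolding I_eq using energy_variation_integrable[OF f' h g] energy_variation_integrable[OF f h g] crit crit'
    by (subst Bochner_Integration.integral_diff) auto
  then have "AE x in M. I x = 0"
    using integral_nonneg_eq_0_iff_AE[OF int] nonneg by simp
  then show ?thesis
  proof eventually_elim
    case (elim x)
    then have "a * (fst (f' x) - fst (f x))\<^sup>2 \<le> 0" using lower[of x] by simp
    then show ?case using a by (simp add: mult_le_0_iff)
  qed
qed

context finite_measure
begin

text \<open>The direct method, carried out with the convexity estimate instead of weak compactness. The closedness
  assumption asks for a representative \<open>F'\<close> of the limit and not for \<open>F\<close> itself, because \<open>K\<close> may contain
  conditions, such as periodicity, that hold at every point and are destroyed by changes on a null set.\<close>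

theorem energy_critical_point:
  fixes K :: "('a \<Rightarrow> real \<times> 'b::euclidean_space) set"
  assumes a: "0 < a" and e: "0 < e"
    and g: "square_integrable M g"
    and zero: "(\<lambda>_. 0) \<in> K"
    and finite: "\<And>f. f \<in> K \<Longrightarrow> finite_energy M f"
    and linear: "\<And>f h s. f \<in> K \<Longrightarrow> h \<in> K \<Longrightarrow> (\<lambda>x. f x + s *\<^sub>R h x) \<in> K"
    and closed: "\<And>f F. (\<And>k. f k \<in> K) \<Longrightarrow> finite_energy M F \<Longrightarrow>
        AE x in M. (\<lambda>k. f k x) \<longlonglongrightarrow> F x \<Longrightarrow>
        (\<lambda>k. \<integral>x. (norm (f k x - F x))\<^sup>2 \<partial>M) \<longlonglongrightarrow> 0 \<Longrightarrow>
        \<exists>F'\<in>K. AE x in M. F' x = F x"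
  shows "\<exists>f\<in>K. \<forall>h\<in>K.
    (\<integral>x. (a * fst (f x) + fst (f x) ^ 3 - g x) * fst (h x) + e * (snd (f x) \<bullet> snd (h x)) \<partial>M) = 0"
proof -
  define E where "E f = (\<integral>x. energy_density a e (g x) (f x) \<partial>M)" for f :: "'a \<Rightarrow> real \<times> 'b"
  have g2: "integrable M (\<lambda>x. (g x)\<^sup>2 / (2 * a))"
    using square_integrable_norm[OF g] by simp
  have dens_int: "integrable M (\<lambda>x. energy_density a e (g x) (f x))" if "finite_energy M f" for f
    using that g by (rule energy_density_integrable)
  define C where "C = (\<integral>x. (g x)\<^sup>2 / (2 * a) \<partial>M)"
  have E_shift: "(\<integral>x. energy_density a e (g x) (f x) + (g x)\<^sup>2 / (2 * a) \<partial>M) = E f + C"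
    if "finite_energy M f" for f
    unfolding E_def C_def using dens_int[OF that] g2 by (rule Bochner_Integration.integral_add)
  have dens_nonneg: "0 \<le> energy_density a e c z + c\<^sup>2 / (2 * a)" for c and z :: "real \<times> 'b"
    by (rule order_trans[OF _ energy_density_lower_bound[OF a e]]) simp
  have E_ge: "- C \<le> E f" if "f \<in> K" for f
  proof -
    have "0 \<le> E f + C"
      unfolding E_shift[OF finite[OF that], symmetric] by (intro Bochner_Integration.integral_nonneg dens_nonneg)
    then show ?thesis by simp
  qed
  have bdd: "bdd_below (E ` K)"
    using E_ge by (auto intro!: bdd_belowI[of _ "- C"])
  define m where "m = Inf (E ` K)"
  have m_le: "m \<le> E f" if "f \<in> K" for f
    unfolding m_def using bdd that by (intro cInf_lower) auto
  have "\<exists>f\<in>K. E f < m + 1 / real (Suc k)" for k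
    using cInf_less_iff[of "E ` K" "m + 1 / real (Suc k)"] bdd zero by (auto simp: m_def)
  then have "\<exists>f. \<forall>k. f k \<in> K \<and> E (f k) < m + 1 / real (Suc k)"
    by (intro choice allI) blast
  then obtain f where fK: "\<And>k. f k \<in> K" and Ef: "\<And>k. E (f k) < m + 1 / real (Suc k)"
    by blast
  have fin: "finite_energy M (f k)" for k
    using finite fK by blast
  have sq: "square_integrable M (f k)" for k
    using fin by (simp add: finite_energy_def)
  define \<mu> where "\<mu> = min a e / 8"
  have \<mu>: "0 < \<mu>" using a e by (simp add: \<mu>_def)
  \<comment> \<open>The midpoint of two elements of \<open>K\<close> has energy at least \<open>m\<close>, so the convexity surplus bounds their distance.\<close>
  have dist: "\<mu> * (\<integral>x. (norm (f i x - f j x))\<^sup>2 \<partial>M) \<le> (E (f i) + E (f j)) / 2 - m" for i j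
  proof -
    define h where "h x = (1/2) *\<^sub>R (f i x + f j x)" for x
    have "(\<lambda>x. f i x + (-1) *\<^sub>R f j x) \<in> K"
      by (intro linear fK)
    from linear[OF fK[of j] this, of "1/2"] have "(\<lambda>x. f j x + (1/2) *\<^sub>R (f i x + (-1) *\<^sub>R f j x)) \<in> K" .
    moreover have "f j x + (1/2) *\<^sub>R (f i x + (-1) *\<^sub>R f j x) = h x" for x
      unfolding h_def by (simp add: algebra_simps flip: scaleR_add_left)
    ultimately have hK: "h \<in> K" by simp
    have int_diff: "integrable M (\<lambda>x. (norm (f i x - f j x))\<^sup>2)"
      by (intro square_integrable_norm square_integrable_diff sq)
    have "E h + \<mu> * (\<integral>x. (norm (f i x - f j x))\<^sup>2 \<partial>M)
        = (\<integral>x. energy_density a e (g x) (h x) + \<mu> * (norm (f i x - f j x))\<^sup>2 \<partial>M)"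
      unfolding E_def using dens_int[OF finite[OF hK]] int_diff
      by (subst Bochner_Integration.integral_add) auto
    also have "\<dots> \<le> (\<integral>x. (energy_density a e (g x) (f i x) + energy_density a e (g x) (f j x)) / 2 \<partial>M)"
    proof (rule integral_mono)
      show "energy_density a e (g x) (h x) + \<mu> * (norm (f i x - f j x))\<^sup>2
          \<le> (energy_density a e (g x) (f i x) + energy_density a e (g x) (f j x)) / 2" for x
        unfolding h_def \<mu>_def by (rule energy_density_midpoint[OF a e])
    qed (use dens_int[OF finite[OF hK]] int_diff dens_int[OF fin[of i]] dens_int[OF fin[of j]] in simp_all)
    also have "\<dots> = (E (f i) + E (f j)) / 2"
      unfolding E_def using dens_int[OF fin[of i]] dens_int[OF fin[of j]] by simp
    finally show ?thesis
      using m_le[OF hK] by argo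
  qed
  have Cauchy: "\<exists>N. \<forall>i\<ge>N. \<forall>j\<ge>N. (\<integral>x. (norm (f i x - f j x))\<^sup>2 \<partial>M) \<le> \<delta>" if \<delta>: "0 < \<delta>" for \<delta>
  proof -
    obtain N where N: "1 / real (Suc N) < \<mu> * \<delta>"
      using nat_approx_posE[of "\<mu> * \<delta>"] \<mu> \<delta> by auto
    have "(\<integral>x. (norm (f i x - f j x))\<^sup>2 \<partial>M) \<le> \<delta>" if "N \<le> i" "N \<le> j" for i j
    proof -
      have "E (f k) - m \<le> 1 / real (Suc N)" if "N \<le> k" for k
      proof -
        have "1 / real (Suc k) \<le> 1 / real (Suc N)"
          using that by (intro divide_left_mono) auto
        then show ?thesis using Ef[of k] by linarith
      qed
      from this[OF \<open>N \<le> i\<close>] this[OF \<open>N \<le> j\<close>]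
      have "\<mu> * (\<integral>x. (norm (f i x - f j x))\<^sup>2 \<partial>M) \<le> \<mu> * \<delta>"
        using dist[of i j] N by argo
      then show ?thesis using \<mu> by simp
    qed
    then show ?thesis by blast
  qed
  obtain r F where r: "strict_mono r" and conv: "AE x in M. (\<lambda>k. f (r k) x) \<longlonglongrightarrow> F x"
    and F: "square_integrable M F"
    and L2: "(\<lambda>k. \<integral>x. (norm (f (r k) x - F x))\<^sup>2 \<partial>M) \<longlonglongrightarrow> 0"
    by (rule L2_complete[OF sq Cauchy])
  note [measurable] = square_integrable_measurable[OF F] square_integrable_measurable[OF g]
    square_integrable_measurable[OF square_integrable_fst[OF F]]
    square_integrable_measurable[OF square_integrable_snd[OF F]]
  \<comment> \<open>Fatou's lemma for the density plus \<open>g\<^sup>2 / (2 a)\<close>, which is nonnegative.\<close>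
  have limit: "integrable M (\<lambda>x. energy_density a e (g x) (F x) + (g x)\<^sup>2 / (2 * a))"
    "(\<integral>x. energy_density a e (g x) (F x) + (g x)\<^sup>2 / (2 * a) \<partial>M) \<le> m + C"
  proof -
    have meas: "(\<lambda>x. energy_density a e (g x) (F x) + (g x)\<^sup>2 / (2 * a)) \<in> borel_measurable M"
      unfolding energy_density_def by measurable
    have int: "integrable M (\<lambda>x. energy_density a e (g x) (f (r k) x) + (g x)\<^sup>2 / (2 * a))" for k
      using dens_int[OF fin] g2 by (rule Bochner_Integration.integrable_add)
    have ptw: "AE x in M. (\<lambda>k. energy_density a e (g x) (f (r k) x) + (g x)\<^sup>2 / (2 * a))
        \<longlonglongrightarrow> energy_density a e (g x) (F x) + (g x)\<^sup>2 / (2 * a)"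
      using conv unfolding energy_density_def by eventually_elim (intro tendsto_intros; simp)
    have bound: "(\<integral>x. energy_density a e (g x) (f (r k) x) + (g x)\<^sup>2 / (2 * a) \<partial>M)
        \<le> m + 1 / real (Suc (r k)) + C" for k
      unfolding E_shift[OF fin] using Ef[of "r k"] by simp
    have "(\<lambda>k. 1 / real (Suc (r k))) \<longlonglongrightarrow> 0"
      using LIMSEQ_subseq_LIMSEQ[OF LIMSEQ_Suc[OF lim_inverse_n'] r]
      by (simp add: o_def)
    then have "(\<lambda>k. m + 1 / real (Suc (r k)) + C) \<longlonglongrightarrow> m + 0 + C"
      by (intro tendsto_intros)
    then have lim: "(\<lambda>k. m + 1 / real (Suc (r k)) + C) \<longlonglongrightarrow> m + C"
      by simp
    show "integrable M (\<lambda>x. energy_density a e (g x) (F x) + (g x)\<^sup>2 / (2 * a))"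
      "(\<integral>x. energy_density a e (g x) (F x) + (g x)\<^sup>2 / (2 * a) \<partial>M) \<le> m + C"
      using integral_le_of_limit[OF meas int dens_nonneg ptw bound lim] by auto
  qed
  have "integrable M (\<lambda>x. fst (F x) ^ 4)"
  proof (rule Bochner_Integration.integrable_bound)
    show "integrable M (\<lambda>x. 4 * (energy_density a e (g x) (F x) + (g x)\<^sup>2 / (2 * a)))"
      using limit(1) by (rule integrable_mult_right)
    have "norm (fst (F x) ^ 4) \<le> norm (4 * (energy_density a e (g x) (F x) + (g x)\<^sup>2 / (2 * a)))" for x
      using energy_density_lower_bound[OF a e, of "F x" "g x"] dens_nonneg[of "g x" "F x"] by simp
    then show "AE x in M. norm (fst (F x) ^ 4)
        \<le> norm (4 * (energy_density a e (g x) (F x) + (g x)\<^sup>2 / (2 * a)))"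
      by (rule AE_I2)
  qed measurable
  with F have finF: "finite_energy M F" by (simp add: finite_energy_def)
  obtain F' where F'K: "F' \<in> K" and F': "AE x in M. F' x = F x"
    using closed[OF fK finF conv L2] by blast
  note finF' = finite[OF F'K]
  have "E F' = E F"
    unfolding E_def
    using borel_measurable_integrable[OF dens_int[OF finF']] borel_measurable_integrable[OF dens_int[OF finF]]
    by (rule integral_cong_AE) (use F' in \<open>eventually_elim, simp\<close>)
  with limit(2) E_shift[OF finF] have min: "E F' \<le> m" by simp
  show ?thesis
  proof (intro bexI[OF _ F'K] ballI)
    fix h assume hK: "h \<in> K"
    note finh = finite[OF hK]
    define w v where "w x = fst (F' x)" and "v x = fst (h x)" for x
    define G H where "G x = snd (F' x)" and "H x = snd (h x)" for x
    have sqi: "square_integrable M w" "square_integrable M v" "square_integrable M G" "square_integrable M H"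
      unfolding w_def[abs_def] v_def[abs_def] G_def[abs_def] H_def[abs_def] using finF' finh
      by (simp_all add: finite_energy_def square_integrable_fst square_integrable_snd)
    have q: "integrable M (\<lambda>x. w x ^ 4)" "integrable M (\<lambda>x. v x ^ 4)"
      using finF' finh by (simp_all add: finite_energy_def w_def v_def)
    note mono = integrable_quartic_monomial[OF sqi(1,2)[THEN square_integrable_measurable] q]
    define A where "A x = (a * w x + w x ^ 3 - g x) * v x + e * (G x \<bullet> H x)" for x
    define B where "B x = a / 2 * (v x)\<^sup>2 + 3 / 2 * ((w x)\<^sup>2 * (v x)\<^sup>2) + e / 2 * (norm (H x))\<^sup>2" for x
    define C' where "C' x = w x * v x ^ 3" for x
    define D where "D x = v x ^ 4 / 4" for x
    have intA: "integrable M A"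
      unfolding A_def w_def v_def G_def H_def using finF' finh g by (rule energy_variation_integrable)
    have intB: "integrable M B"
      unfolding B_def using square_integrable_norm[OF sqi(2)] square_integrable_norm[OF sqi(4)] mono[of 2 2]
      by simp
    have intC: "integrable M C'"
      unfolding C'_def using mono[of 1 3] by simp
    have intD: "integrable M D"
      unfolding D_def using q by simp
    have "0 \<le> s * integral\<^sup>L M A + s\<^sup>2 * integral\<^sup>L M B + s ^ 3 * integral\<^sup>L M C' + s ^ 4 * integral\<^sup>L M D" for s
    proof -
      have "E (\<lambda>x. F' x + s *\<^sub>R h x) = (\<integral>x. energy_density a e (g x) (F' x)
          + s * A x + s\<^sup>2 * B x + s ^ 3 * C' x + s ^ 4 * D x \<partial>M)"
        unfolding E_def energy_density_expand A_def B_def C'_def D_def w_def v_def G_def H_def ..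
      also have "\<dots> = E F' + s * integral\<^sup>L M A + s\<^sup>2 * integral\<^sup>L M B
          + s ^ 3 * integral\<^sup>L M C' + s ^ 4 * integral\<^sup>L M D"
        unfolding E_def using dens_int[OF finF'] intA intB intC intD by simp
      finally show ?thesis
        using min m_le[OF linear[OF F'K hK, of s]] by simp
    qed
    then have "integral\<^sup>L M A = 0"
      by (rule linear_term_zero_at_minimum)
    then show "(\<integral>x. (a * fst (F' x) + fst (F' x) ^ 3 - g x) * fst (h x)
        + e * (snd (F' x) \<bullet> snd (h x)) \<partial>M) = 0"
      by (simp add: A_def[abs_def] w_def v_def G_def H_def)
  qed
qed

end

section \<open>Weak gradients on the periodic cell\<close>

lemma bounded_cell: "bounded (cell p)" for p :: "'d::finite \<Rightarrow> real ^ 'd"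
proof -
  have "norm x \<le> (\<Sum>i\<in>UNIV. norm (p i))" if mem: "x \<in> cell p" for x
  proof -
    obtain s where x: "x = (\<Sum>i\<in>UNIV. s i *\<^sub>R p i)" and s: "\<forall>i. 0 < s i \<and> s i < 1"
      using mem unfolding cell_def by blast
    have "norm (s i *\<^sub>R p i) \<le> norm (p i)" for i
      using spec[OF s, of i] by (simp add: mult_left_le_one_le)
    then show ?thesis
      unfolding x by (rule sum_norm_le)
  qed
  then show ?thesis
    unfolding bounded_iff by blast
qed

lemma cell_lmeasurable: "cell p \<in> lmeasurable" for p :: "'d::finite \<Rightarrow> real ^ 'd"
proof (rule measurable_convex)
  show "convex (cell p)"
  proof (rule convexI)
    fix x y :: "real ^ 'd" and \<alpha> \<beta> :: real
    assume "x \<in> cell p" "y \<in> cell p" and \<alpha>\<beta>: "0 \<le> \<alpha>" "0 \<le> \<beta>" "\<alpha> + \<beta> = 1"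
    then obtain s s' where s: "x = (\<Sum>i\<in>UNIV. s i *\<^sub>R p i)" "\<forall>i. s i \<in> {0<..<1}"
      and s': "y = (\<Sum>i\<in>UNIV. s' i *\<^sub>R p i)" "\<forall>i. s' i \<in> {0<..<1}"
      unfolding cell_def by auto
    have "\<alpha> * s i + \<beta> * s' i \<in> {0<..<1}" for i
      using convexD[of "{0<..<1::real}" "s i" "s' i" \<alpha> \<beta>] s(2) s'(2) \<alpha>\<beta> by simp
    moreover have "\<alpha> *\<^sub>R x + \<beta> *\<^sub>R y = (\<Sum>i\<in>UNIV. (\<alpha> * s i + \<beta> * s' i) *\<^sub>R p i)"
      by (simp add: s(1) s'(1) scaleR_sum_right sum.distrib scaleR_add_left)
    ultimately show "\<alpha> *\<^sub>R x + \<beta> *\<^sub>R y \<in> cell p"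
      unfolding cell_def by auto
  qed
qed (rule bounded_cell)

text \<open>Smoothness provides some continuous gradient; it coincides with the given one because gradients are
  unique.\<close>

lemma smooth_continuous_gradient:
  assumes "smooth \<phi>" and D: "\<And>x. GDERIV \<phi> x :> D x"
  shows "continuous_on UNIV \<phi>" and "continuous_on UNIV D"
proof -
  have "C_k 0 \<phi>" "C_k (Suc 0) \<phi>"
    using assms(1) unfolding smooth_def by blast+
  then show "continuous_on UNIV \<phi>" by simp
  obtain D' where D': "\<And>x. GDERIV \<phi> x :> D' x" and cont: "\<And>i. continuous_on UNIV (\<lambda>x. D' x $ i)"
    using \<open>C_k (Suc 0) \<phi>\<close> by auto
  have "D x = D' x" for x
  proof -
    have eq: "(\<lambda>h. h \<bullet> D x) = (\<lambda>h. h \<bullet> D' x)"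
      using D[of x] D'[of x] unfolding gderiv_def by (rule has_derivative_unique)
    have "(D x - D' x) \<bullet> D x = (D x - D' x) \<bullet> D' x"
      using fun_cong[OF eq, of "D x - D' x"] by (simp only:)
    then have "(D x - D' x) \<bullet> (D x - D' x) = 0"
      by (simp only: inner_diff_right diff_self)
    then show ?thesis by simp
  qed
  then have "D = (\<lambda>x. \<chi> i. D' x $ i)"
    by (simp add: fun_eq_iff)
  moreover have "continuous_on UNIV (\<lambda>x. \<chi> i. D' x $ i)"
    using cont by (rule continuous_on_vec_lambda)
  ultimately show "continuous_on UNIV D" by simp
qed

lemma continuous_bounded_on_cell:
  fixes f :: "real ^ 'd::finite \<Rightarrow> 'b::euclidean_space"
  assumes "continuous_on UNIV f"
  shows "f \<in> borel_measurable (lebesgue_on (cell p))"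
    and "\<exists>B. \<forall>x\<in>cell p. norm (f x) \<le> B"
proof -
  show "f \<in> borel_measurable (lebesgue_on (cell p))"
    using fmeasurableD[OF cell_lmeasurable] continuous_on_subset[OF assms subset_UNIV]
    by (intro continuous_imp_measurable_on_sets_lebesgue)
  have "compact (f ` closure (cell p))"
    using assms bounded_cell[of p] by (intro compact_continuous_image continuous_on_subset[OF assms]) (auto simp: compact_closure)
  then have "bounded (f ` closure (cell p))"
    by (rule compact_imp_bounded)
  then show "\<exists>B. \<forall>x\<in>cell p. norm (f x) \<le> B"
    unfolding bounded_iff using closure_subset by blast
qed

lemma integrable_scaleR_bounded:
  fixes u :: "'a \<Rightarrow> real" and D :: "'a \<Rightarrow> 'b::euclidean_space"
  assumes "integrable M u" "D \<in> borel_measurable M" "\<And>x. x \<in> space M \<Longrightarrow> norm (D x) \<le> B"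
  shows "integrable M (\<lambda>x. u x *\<^sub>R D x)"
proof (rule Bochner_Integration.integrable_bound)
  show "integrable M (\<lambda>x. B * norm (u x))"
    using assms(1) by simp
  show "(\<lambda>x. u x *\<^sub>R D x) \<in> borel_measurable M"
    using assms(2) borel_measurable_integrable[OF assms(1)] by measurable
  show "AE x in M. norm (u x *\<^sub>R D x) \<le> norm (B * norm (u x))"
  proof (rule AE_I2)
    fix x assume "x \<in> space M"
    then have "norm (D x) \<le> \<bar>B\<bar>" using assms(3)[of x] by linarith
    then show "norm (u x *\<^sub>R D x) \<le> norm (B * norm (u x))"
      by (simp add: abs_mult mult.commute[of "\<bar>B\<bar>"] mult_left_mono)
  qed
qed

lemma integrable_bounded_scaleR:
  fixes \<phi> :: "'a \<Rightarrow> real" and G :: "'a \<Rightarrow> 'b::euclidean_space"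
  assumes "integrable M G" "\<phi> \<in> borel_measurable M" "\<And>x. x \<in> space M \<Longrightarrow> norm (\<phi> x) \<le> B"
  shows "integrable M (\<lambda>x. \<phi> x *\<^sub>R G x)"
proof (rule Bochner_Integration.integrable_bound)
  show "integrable M (\<lambda>x. B * norm (G x))"
    using assms(1) by simp
  show "(\<lambda>x. \<phi> x *\<^sub>R G x) \<in> borel_measurable M"
    using assms(2) borel_measurable_integrable[OF assms(1)] by measurable
  show "AE x in M. norm (\<phi> x *\<^sub>R G x) \<le> norm (B * norm (G x))"
  proof (rule AE_I2)
    fix x assume "x \<in> space M"
    then have "\<bar>\<phi> x\<bar> \<le> \<bar>B\<bar>" using assms(3)[of x] by simp
    then show "norm (\<phi> x *\<^sub>R G x) \<le> norm (B * norm (G x))"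
      by (simp add: abs_mult mult_right_mono)
  qed
qed

lemma tendsto_integral_of_L1_bound:
  fixes h :: "nat \<Rightarrow> 'a \<Rightarrow> 'b::euclidean_space"
  assumes h: "\<And>k. integrable M (h k)" and h': "integrable M h'" and \<delta>: "\<And>k. integrable M (\<delta> k)"
    and le: "\<And>k x. x \<in> space M \<Longrightarrow> norm (h k x - h' x) \<le> B * \<delta> k x"
    and lim: "(\<lambda>k. \<integral>x. \<delta> k x \<partial>M) \<longlonglongrightarrow> 0"
  shows "(\<lambda>k. integral\<^sup>L M (h k)) \<longlonglongrightarrow> integral\<^sup>L M h'"
proof -
  have "norm (integral\<^sup>L M (h k) - integral\<^sup>L M h') \<le> B * (\<integral>x. \<delta> k x \<partial>M)" for k
  proof -
    have "norm (integral\<^sup>L M (h k) - integral\<^sup>L M h') = norm (\<integral>x. h k x - h' x \<partial>M)"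
      by (simp add: h h')
    also have "\<dots> \<le> (\<integral>x. norm (h k x - h' x) \<partial>M)"
      by (rule integral_norm_bound)
    also have "\<dots> \<le> (\<integral>x. B * \<delta> k x \<partial>M)"
      using le by (intro integral_mono integrable_norm Bochner_Integration.integrable_diff h h' integrable_mult_right \<delta>)
    finally show ?thesis by simp
  qed
  moreover have "(\<lambda>k. B * (\<integral>x. \<delta> k x \<partial>M)) \<longlonglongrightarrow> 0"
    using tendsto_mult_right_zero[OF lim] .
  ultimately have "(\<lambda>k. integral\<^sup>L M (h k) - integral\<^sup>L M h') \<longlonglongrightarrow> 0"
    by (rule Lim_null_comparison[OF always_eventually[OF allI]])
  then show ?thesis by (rule LIM_zero_cancel)
qed

text \<open>The graph of the weak gradient over the function space. Pairs that agree almost everywhere remain distinct here, and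
  all gradients of a function occur, so no choice of gradient is needed.\<close>

definition V_pairs :: "('d::finite \<Rightarrow> real ^ 'd) \<Rightarrow> (real ^ 'd \<Rightarrow> real \<times> (real ^ 'd)) set" where
  "V_pairs p = {f. periodic p (\<lambda>x. fst (f x)) \<and> finite_energy (lebesgue_on (cell p)) f \<and>
     has_weak_gradient p (\<lambda>x. fst (f x)) (\<lambda>x. snd (f x))}"

lemma in_L2_iff: "in_Lp 2 S f \<longleftrightarrow> square_integrable (lebesgue_on S) f"
  by (simp add: in_Lp_def square_integrable_def)

lemma V_pairs_iff: "(\<lambda>x. (u x, G x)) \<in> V_pairs p \<longleftrightarrow> u \<in> V_space p \<and> has_weak_gradient p u G"
  unfolding V_pairs_def V_space_def finite_energy_def
  by (auto simp: in_L2_iff square_integrable_Pair in_Lp_def[of 4] has_weak_gradient_def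
      square_integrable_measurable)

context
  fixes p :: "'d::finite \<Rightarrow> real ^ 'd" and M
  defines "M \<equiv> lebesgue_on (cell p)"
begin

interpretation M: finite_measure M
  unfolding M_def by (rule finite_measure_lebesgue_on[OF cell_lmeasurable])

lemma weak_gradient_tests_integrable:
  assumes "smooth \<phi>" "\<And>x. GDERIV \<phi> x :> D x"
    and u: "square_integrable M u" and G: "square_integrable M (G :: _ \<Rightarrow> real ^ 'd)"
  shows "integrable M (\<lambda>x. u x *\<^sub>R D x)" and "integrable M (\<lambda>x. \<phi> x *\<^sub>R G x)"
proof -
  note cont = smooth_continuous_gradient[OF assms(1,2)]
  obtain B where "\<forall>x\<in>cell p. norm (D x) \<le> B"
    using continuous_bounded_on_cell(2)[OF cont(2)] by blast
  then show "integrable M (\<lambda>x. u x *\<^sub>R D x)"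
    using continuous_bounded_on_cell(1)[OF cont(2), of p] M.square_integrable_integrable[OF u]
    by (intro integrable_scaleR_bounded[where B=B]) (auto simp: M_def)
  obtain B where "\<forall>x\<in>cell p. norm (\<phi> x) \<le> B"
    using continuous_bounded_on_cell(2)[OF cont(1)] by blast
  then show "integrable M (\<lambda>x. \<phi> x *\<^sub>R G x)"
    using continuous_bounded_on_cell(1)[OF cont(1), of p] M.square_integrable_integrable[OF G]
    by (intro integrable_bounded_scaleR[where B=B]) (auto simp: M_def)
qed

lemma has_weak_gradient_iff:
  "has_weak_gradient p u G \<longleftrightarrow> square_integrable M G \<and>
     (\<forall>\<phi> D. smooth \<phi> \<and> periodic p \<phi> \<and> (\<forall>x. GDERIV \<phi> x :> D x) \<longrightarrow>
       (\<integral>x. u x *\<^sub>R D x \<partial>M) = - (\<integral>x. \<phi> x *\<^sub>R G x \<partial>M))"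
  by (simp add: has_weak_gradient_def in_L2_iff M_def)

lemma has_weak_gradient_lincomb:
  assumes u: "square_integrable M u" "has_weak_gradient p u G"
    and v: "square_integrable M v" "has_weak_gradient p v H"
  shows "has_weak_gradient p (\<lambda>x. u x + s * v x) (\<lambda>x. G x + s *\<^sub>R H x)"
  unfolding has_weak_gradient_iff
proof (intro conjI allI impI)
  have G: "square_integrable M G" and H: "square_integrable M H"
    using u v by (auto simp: has_weak_gradient_iff)
  then show "square_integrable M (\<lambda>x. G x + s *\<^sub>R H x)"
    by (intro square_integrable_add square_integrable_scaleR)
  fix \<phi> D assume \<phi>: "smooth \<phi> \<and> periodic p \<phi> \<and> (\<forall>x. GDERIV \<phi> x :> D x)"
  note iu = weak_gradient_tests_integrable[of \<phi> D, OF _ _ u(1) G]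
  note iv = weak_gradient_tests_integrable[of \<phi> D, OF _ _ v(1) H]
  have "(\<integral>x. (u x + s * v x) *\<^sub>R D x \<partial>M) = (\<integral>x. u x *\<^sub>R D x + s *\<^sub>R (v x *\<^sub>R D x) \<partial>M)"
    by (simp add: scaleR_add_left)
  also have "\<dots> = (\<integral>x. u x *\<^sub>R D x \<partial>M) + s *\<^sub>R (\<integral>x. v x *\<^sub>R D x \<partial>M)"
    using \<phi> iu(1) iv(1) by (simp del: scaleR_scaleR)
  also have "\<dots> = - ((\<integral>x. \<phi> x *\<^sub>R G x \<partial>M) + s *\<^sub>R (\<integral>x. \<phi> x *\<^sub>R H x \<partial>M))"
    using \<phi> u(2) v(2) by (simp add: has_weak_gradient_iff)
  also have "\<dots> = - (\<integral>x. \<phi> x *\<^sub>R G x + s *\<^sub>R (\<phi> x *\<^sub>R H x) \<partial>M)"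
    using \<phi> iu(2) iv(2) by (simp del: scaleR_scaleR)
  also have "\<dots> = - (\<integral>x. \<phi> x *\<^sub>R (G x + s *\<^sub>R H x) \<partial>M)"
    by (simp add: scaleR_add_right mult.commute)
  finally show "(\<integral>x. (u x + s * v x) *\<^sub>R D x \<partial>M) = - (\<integral>x. \<phi> x *\<^sub>R (G x + s *\<^sub>R H x) \<partial>M)" .
qed

text \<open>Both sides of the integration-by-parts identity are continuous in \<open>L\<^sup>1\<close>, since test functions and
  their gradients are continuous and hence bounded on the bounded cell.\<close>

lemma has_weak_gradient_limit:
  fixes f :: "nat \<Rightarrow> real ^ 'd \<Rightarrow> real \<times> (real ^ 'd)"
  assumes f: "\<And>k. square_integrable M (f k)" and F: "square_integrable M F"
    and wg: "\<And>k. has_weak_gradient p (\<lambda>x. fst (f k x)) (\<lambda>x. snd (f k x))"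
    and lim: "(\<lambda>k. \<integral>x. (norm (f k x - F x))\<^sup>2 \<partial>M) \<longlonglongrightarrow> 0"
  shows "has_weak_gradient p (\<lambda>x. fst (F x)) (\<lambda>x. snd (F x))"
  unfolding has_weak_gradient_iff
proof (intro conjI allI impI)
  show "square_integrable M (\<lambda>x. snd (F x))"
    using F by (rule square_integrable_snd)
  fix \<phi> D assume \<phi>: "smooth \<phi> \<and> periodic p \<phi> \<and> (\<forall>x. GDERIV \<phi> x :> D x)"
  then have \<phi>': "smooth \<phi>" "\<And>x. GDERIV \<phi> x :> D x" by auto
  have diff: "square_integrable M (\<lambda>x. f k x - F x)" for k
    using f F by (rule square_integrable_diff)
  have L1: "(\<lambda>k. \<integral>x. norm (f k x - F x) \<partial>M) \<longlonglongrightarrow> 0"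
    using diff lim by (rule M.L1_limit_of_L2_limit)
  have L1_int: "integrable M (\<lambda>x. norm (f k x - F x))" for k
    by (intro integrable_norm M.square_integrable_integrable diff)
  have fst_le: "\<bar>fst z\<bar> \<le> norm z" and snd_le: "norm (snd z) \<le> norm z" for z :: "real \<times> (real ^ 'd)"
    using norm_fst_le[of "fst z" "snd z"] norm_snd_le[of "snd z" "fst z"] by simp_all
  note cont = smooth_continuous_gradient[OF \<phi>']
  note int = weak_gradient_tests_integrable[OF \<phi>' square_integrable_fst square_integrable_snd]
  obtain B where B: "\<forall>x\<in>cell p. norm (D x) \<le> B"
    using continuous_bounded_on_cell(2)[OF cont(2)] by blast
  have "(\<lambda>k. \<integral>x. fst (f k x) *\<^sub>R D x \<partial>M) \<longlonglongrightarrow> (\<integral>x. fst (F x) *\<^sub>R D x \<partial>M)"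
  proof (rule tendsto_integral_of_L1_bound[OF int(1)[OF f f] int(1)[OF F F] L1_int _ L1])
    fix k x assume "x \<in> space M"
    then have "norm (D x) \<le> B" using B by (simp add: M_def)
    then have "norm (D x) * \<bar>fst (f k x - F x)\<bar> \<le> B * norm (f k x - F x)"
      using fst_le[of "f k x - F x"] by (intro mult_mono) (auto intro: order_trans[OF norm_ge_zero])
    then show "norm (fst (f k x) *\<^sub>R D x - fst (F x) *\<^sub>R D x) \<le> B * norm (f k x - F x)"
      by (simp add: mult.commute flip: scaleR_diff_left)
  qed
  moreover obtain B' where B': "\<forall>x\<in>cell p. norm (\<phi> x) \<le> B'"
    using continuous_bounded_on_cell(2)[OF cont(1)] by blast
  have "(\<lambda>k. \<integral>x. \<phi> x *\<^sub>R snd (f k x) \<partial>M) \<longlonglongrightarrow> (\<integral>x. \<phi> x *\<^sub>R snd (F x) \<partial>M)"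
  proof (rule tendsto_integral_of_L1_bound[OF int(2)[OF f f] int(2)[OF F F] L1_int _ L1])
    fix k x assume "x \<in> space M"
    then have "\<bar>\<phi> x\<bar> \<le> B'" using B' by (simp add: M_def)
    then have "\<bar>\<phi> x\<bar> * norm (snd (f k x - F x)) \<le> B' * norm (f k x - F x)"
      using snd_le[of "f k x - F x"] by (intro mult_mono) (auto intro: order_trans[OF abs_ge_zero])
    then show "norm (\<phi> x *\<^sub>R snd (f k x) - \<phi> x *\<^sub>R snd (F x)) \<le> B' * norm (f k x - F x)"
      by (simp flip: scaleR_diff_right)
  qed
  then have "(\<lambda>k. - (\<integral>x. \<phi> x *\<^sub>R snd (f k x) \<partial>M)) \<longlonglongrightarrow> - (\<integral>x. \<phi> x *\<^sub>R snd (F x) \<partial>M)"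
    by (rule tendsto_minus)
  moreover have "(\<integral>x. fst (f k x) *\<^sub>R D x \<partial>M) = - (\<integral>x. \<phi> x *\<^sub>R snd (f k x) \<partial>M)" for k
    using wg[of k] \<phi> by (simp add: has_weak_gradient_iff)
  ultimately show "(\<integral>x. fst (F x) *\<^sub>R D x \<partial>M) = - (\<integral>x. \<phi> x *\<^sub>R snd (F x) \<partial>M)"
    using LIMSEQ_unique by simp
qed

lemma V_pairs_finite_energy: "f \<in> V_pairs p \<Longrightarrow> finite_energy M f"
  by (simp add: V_pairs_def M_def)

lemma V_pairs_zero: "(\<lambda>_. 0) \<in> V_pairs p"
  by (simp add: V_pairs_def periodic_def finite_energy_def square_integrable_def
      has_weak_gradient_def in_Lp_def)

lemma V_pairs_lincomb:
  assumes "f \<in> V_pairs p" "h \<in> V_pairs p"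
  shows "(\<lambda>x. f x + s *\<^sub>R h x) \<in> V_pairs p"
proof -
  have sq: "square_integrable M f" "square_integrable M h"
    using assms by (auto simp: V_pairs_def finite_energy_def M_def)
  note fst_sq = sq[THEN square_integrable_fst]
  have "integrable M (\<lambda>x. (fst (f x) + s * fst (h x)) ^ 4)"
    using assms fst_sq[THEN square_integrable_measurable]
    by (intro integrable_power4_add) (auto simp: V_pairs_def finite_energy_def M_def power_mult_distrib)
  then have "finite_energy M (\<lambda>x. f x + s *\<^sub>R h x)"
    using sq by (simp add: finite_energy_def square_integrable_add square_integrable_scaleR)
  moreover have "has_weak_gradient p (\<lambda>x. fst (f x) + s * fst (h x)) (\<lambda>x. snd (f x) + s *\<^sub>R snd (h x))"
    using assms fst_sq by (intro has_weak_gradient_lincomb) (auto simp: V_pairs_def)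
  ultimately show ?thesis
    using assms by (simp add: V_pairs_def periodic_def M_def)
qed

text \<open>The function component of the limit is replaced by the pointwise limit of the representatives. Outside the set of
  convergence this takes the fixed value of \<open>lim\<close> on divergent sequences; in every case it depends
  on \<open>x\<close> only through the values at \<open>x\<close> of periodic functions, so it is periodic on the whole space and not just
  almost everywhere.\<close>

lemma V_pairs_closed:
  assumes f: "\<And>k. f k \<in> V_pairs p" and F: "finite_energy M F"
    and conv: "AE x in M. (\<lambda>k. f k x) \<longlonglongrightarrow> F x"
    and L2: "(\<lambda>k. \<integral>x. (norm (f k x - F x))\<^sup>2 \<partial>M) \<longlonglongrightarrow> 0"
  shows "\<exists>F'\<in>V_pairs p. AE x in M. F' x = F x"
proof
  have sqf: "square_integrable M (f k)" for k
    using f by (simp add: V_pairs_def finite_energy_def M_def)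
  have sqF: "square_integrable M F" using F by (simp add: finite_energy_def)
  note [measurable] = square_integrable_measurable[OF sqF]
    square_integrable_measurable[OF square_integrable_fst[OF sqF]]
    square_integrable_measurable[OF square_integrable_snd[OF sqF]]
    square_integrable_measurable[OF square_integrable_fst[OF sqf]]
    square_integrable_measurable[OF sqf]
  define w where "w x = lim (\<lambda>k. fst (f k x))" for x
  have [measurable]: "w \<in> borel_measurable M"
    unfolding w_def by measurable
  define F' where "F' x = (w x, snd (F x))" for x
  have [measurable]: "F' \<in> borel_measurable M"
    unfolding F'_def by measurable
  show ae: "AE x in M. F' x = F x"
    using conv
  proof eventually_elim
    case (elim x)
    have "w x = fst (F x)"
      unfolding w_def using tendsto_fst[OF elim] by (rule limI)
    then show ?case by (simp add: F'_def)
  qed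
  have ae_fst: "AE x in M. fst (F' x) ^ 4 = fst (F x) ^ 4"
    using ae by eventually_elim simp
  have ae_norm: "AE x in M. (norm (F' x))\<^sup>2 = (norm (F x))\<^sup>2"
    using ae by eventually_elim simp
  have "integrable M (\<lambda>x. (norm (F' x))\<^sup>2)"
    using sqF by (subst integrable_cong_AE[OF _ _ ae_norm]) (auto simp: square_integrable_def)
  then have sqF': "square_integrable M F'"
    by (simp add: square_integrable_def)
  have "integrable M (\<lambda>x. fst (F' x) ^ 4)"
    using F by (subst integrable_cong_AE[OF _ _ ae_fst]) (auto simp: finite_energy_def F'_def)
  then have finF': "finite_energy M F'"
    using sqF' by (simp add: finite_energy_def)
  have "(\<integral>x. (norm (f k x - F' x))\<^sup>2 \<partial>M) = (\<integral>x. (norm (f k x - F x))\<^sup>2 \<partial>M)" for k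
    by (rule integral_cong_AE) (measurable, use ae in \<open>eventually_elim, simp\<close>)
  then have "(\<lambda>k. \<integral>x. (norm (f k x - F' x))\<^sup>2 \<partial>M) \<longlonglongrightarrow> 0"
    using L2 by simp
  then have "has_weak_gradient p (\<lambda>x. fst (F' x)) (\<lambda>x. snd (F' x))"
    using f by (intro has_weak_gradient_limit[OF sqf sqF']) (auto simp: V_pairs_def)
  moreover have "periodic p (\<lambda>x. fst (F' x))"
    using f by (simp add: F'_def w_def periodic_def V_pairs_def)
  ultimately show "F' \<in> V_pairs p"
    using finF' by (simp add: V_pairs_def M_def)
qed

end

section \<open>The scheme at one time level\<close>

lemma square_integrable_sum:
  assumes "\<And>k. k \<in> S \<Longrightarrow> square_integrable M (f k)"
  shows "square_integrable M (\<lambda>x. \<Sum>k\<in>S. f k x)"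
  using assms
proof (induction S rule: infinite_finite_induct)
  case (insert k S)
  then have "square_integrable M (\<lambda>x. f k x + (\<Sum>k\<in>S. f k x))"
    by (intro square_integrable_add) auto
  then show ?case using insert.hyps by simp
qed (simp_all add: square_integrable_def)

lemma bdf3_coeff_eq_0: "3 \<le> j \<Longrightarrow> bdf3_coeff t n j = 0"
  by (simp add: bdf3_coeff_def Let_def)

definition known_part :: "(nat \<Rightarrow> real) \<Rightarrow> nat \<Rightarrow> (nat \<Rightarrow> 'a \<Rightarrow> real) \<Rightarrow> 'a \<Rightarrow> real" where
  "known_part t n u x = bdf3_coeff t n 0 * u (n - 1) x
     - (\<Sum>k=1..<n. bdf3_coeff t n (n - k) * (u k x - u (k - 1) x))"

lemma D3_fun_upd:
  assumes "1 \<le> n"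
  shows "D3 t n (u(n := w)) x = bdf3_coeff t n 0 * w x - known_part t n u x"
proof -
  have "{1..n} = insert n {1..<n}" using assms by auto
  moreover have "(\<Sum>k=1..<n. bdf3_coeff t n (n - k) * ((u(n := w)) k x - (u(n := w)) (k - 1) x))
      = (\<Sum>k=1..<n. bdf3_coeff t n (n - k) * (u k x - u (k - 1) x))"
    by (rule sum.cong) auto
  moreover have "n - 1 \<noteq> n" using assms by simp
  ultimately show ?thesis
    using assms by (simp add: D3_def known_part_def algebra_simps)
qed

text \<open>Only three previous levels matter: the coefficients of older increments vanish.\<close>

lemma known_part_square_integrable:
  assumes "1 \<le> n" and u: "\<And>k. n - 3 \<le> k \<Longrightarrow> k < n \<Longrightarrow> square_integrable M (u k)"
  shows "square_integrable M (known_part t n u)"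
proof -
  have summand: "square_integrable M (\<lambda>x. bdf3_coeff t n (n - k) *\<^sub>R (u k x - u (k - 1) x))"
    if "k \<in> {1..<n}" for k
  proof (cases "n - k < 3")
    case True
    with that show ?thesis
      by (intro square_integrable_scaleR square_integrable_diff u) auto
  next
    case False
    then show ?thesis
      by (simp add: bdf3_coeff_eq_0 square_integrable_def)
  qed
  have "square_integrable M (\<lambda>x. bdf3_coeff t n 0 *\<^sub>R u (n - 1) x
      - (\<Sum>k=1..<n. bdf3_coeff t n (n - k) *\<^sub>R (u k x - u (k - 1) x)))"
    using \<open>1 \<le> n\<close>
    by (intro square_integrable_diff square_integrable_scaleR square_integrable_sum summand u) auto
  then show ?thesis
    by (simp add: known_part_def[abs_def])
qed

lemma step_pos:
  assumes "time_mesh N T t" "1 \<le> k" "k \<le> N"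
  shows "0 < step t k"
  using assms by (cases k) (auto simp: time_mesh_def step_def)

lemma ratio_nonneg:
  assumes "time_mesh N T t" "k \<le> N"
  shows "0 \<le> ratio t k"
proof (cases "2 \<le> k")
  case True
  then have "0 < step t k" "0 < step t (k - 1)"
    using assms(2) by (auto intro!: step_pos[OF assms(1)])
  with True show ?thesis
    by (simp add: ratio_def)
qed (simp add: ratio_def)

text \<open>The three definitions of the leading coefficient agree under the convention that the ratio vanishes at the
  indices 0 and 1. The formula exhibits the step-size condition as \<open>b > 1\<close>.\<close>

lemma bdf3_leading_coeff:
  assumes mesh: "time_mesh N T t" and n: "1 \<le> n" "n \<le> N"
  shows "bdf3_coeff t n 0 = (1 + 2 * ratio t n + ratio t (n - 1) * (1 + 4 * ratio t n + 3 * (ratio t n)\<^sup>2)) /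
      ((1 + ratio t n) * (1 + ratio t (n - 1) + ratio t n * ratio t (n - 1))) / step t n"
proof -
  have "1 + ratio t (n - 1) \<noteq> 0"
    using ratio_nonneg[OF mesh, of "n - 1"] n by fastforce
  moreover have "ratio t 1 = 0" "ratio t 0 = 0" "ratio t (Suc 0) = 0" by (simp_all add: ratio_def)
  ultimately show ?thesis
    by (simp add: bdf3_coeff_def Let_def mult_ac)
qed

text \<open>The linear part \<open>- w\<close> of the nonlinearity moves into the zeroth-order coefficient, which turns the scheme into the
  critical-point equation of the energy with \<open>a = b - 1\<close> and \<open>e = \<epsilon>\<^sup>2\<close>.\<close>

lemma bdf3_scheme_iff:
  assumes n: "1 \<le> n" and g: "square_integrable (lebesgue_on (cell p)) (known_part t n u)"
    and w: "w \<in> V_space p"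
  shows "bdf3_scheme_at p \<epsilon> t n (u(n := w)) \<longleftrightarrow>
    (\<exists>G. (\<lambda>x. (w x, G x)) \<in> V_pairs p \<and> (\<forall>h\<in>V_pairs p.
      (\<integral>x. ((bdf3_coeff t n 0 - 1) * w x + w x ^ 3 - known_part t n u x) * fst (h x)
        + \<epsilon>\<^sup>2 * (G x \<bullet> snd (h x)) \<partial>lebesgue_on (cell p)) = 0))"
proof -
  define M where "M = lebesgue_on (cell p)"
  define b where "b = bdf3_coeff t n 0"
  define g where "g = known_part t n u"
  have sg: "square_integrable M g" using g by (simp add: M_def g_def)
  have eq: "L2_inner (cell p) (D3 t n (u(n := w))) v + \<epsilon>\<^sup>2 * L2_inner (cell p) G H
      + L2_inner (cell p) (\<lambda>x. ac_nonlinearity (w x)) v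
    = (\<integral>x. ((b - 1) * w x + w x ^ 3 - g x) * v x + \<epsilon>\<^sup>2 * (G x \<bullet> H x) \<partial>M)"
    if f: "(\<lambda>x. (w x, G x)) \<in> V_pairs p" and h: "(\<lambda>x. (v x, H x)) \<in> V_pairs p" for G v H
  proof -
    have sq: "square_integrable M w" "square_integrable M v" "square_integrable M G" "square_integrable M H"
      using V_pairs_finite_energy[OF f] V_pairs_finite_energy[OF h]
      by (auto simp: finite_energy_def square_integrable_Pair M_def)
    have "integrable M (\<lambda>x. w x ^ 3 * v x ^ 1)"
      using V_pairs_finite_energy[OF f] V_pairs_finite_energy[OF h] sq
      by (intro integrable_quartic_monomial) (auto simp: finite_energy_def M_def square_integrable_def)
    then have i3: "integrable M (\<lambda>x. w x ^ 3 * v x)" by simp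
    have i1: "integrable M (\<lambda>x. w x * v x)" and i2: "integrable M (\<lambda>x. g x * v x)"
      and i4: "integrable M (\<lambda>x. G x \<bullet> H x)"
      using square_integrable_inner[OF sq(1,2)] square_integrable_inner[OF sg sq(2)]
        square_integrable_inner[OF sq(3,4)] by simp_all
    have "L2_inner (cell p) (D3 t n (u(n := w))) v = (\<integral>x. b * (w x * v x) - g x * v x \<partial>M)"
      unfolding L2_inner_def D3_fun_upd[OF n] M_def b_def g_def
      by (simp add: algebra_simps)
    also have "\<dots> = b * (\<integral>x. w x * v x \<partial>M) - (\<integral>x. g x * v x \<partial>M)"
      using i1 i2 by simp
    finally have D: "L2_inner (cell p) (D3 t n (u(n := w))) v = b * (\<integral>x. w x * v x \<partial>M) - (\<integral>x. g x * v x \<partial>M)" .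
    have "L2_inner (cell p) (\<lambda>x. ac_nonlinearity (w x)) v = (\<integral>x. w x ^ 3 * v x - w x * v x \<partial>M)"
      by (simp add: L2_inner_def ac_nonlinearity_def M_def left_diff_distrib)
    also have "\<dots> = (\<integral>x. w x ^ 3 * v x \<partial>M) - (\<integral>x. w x * v x \<partial>M)"
      using i1 i3 by simp
    finally have N: "L2_inner (cell p) (\<lambda>x. ac_nonlinearity (w x)) v
        = (\<integral>x. w x ^ 3 * v x \<partial>M) - (\<integral>x. w x * v x \<partial>M)" .
    have "(\<integral>x. ((b - 1) * w x + w x ^ 3 - g x) * v x + \<epsilon>\<^sup>2 * (G x \<bullet> H x) \<partial>M)
        = (\<integral>x. (b - 1) * (w x * v x) + w x ^ 3 * v x - g x * v x + \<epsilon>\<^sup>2 * (G x \<bullet> H x) \<partial>M)"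
      by (simp add: algebra_simps)
    also have "\<dots> = (b - 1) * (\<integral>x. w x * v x \<partial>M) + (\<integral>x. w x ^ 3 * v x \<partial>M)
        - (\<integral>x. g x * v x \<partial>M) + \<epsilon>\<^sup>2 * (\<integral>x. G x \<bullet> H x \<partial>M)"
      using i1 i2 i3 i4 by simp
    finally show ?thesis
      unfolding D N by (simp add: L2_inner_def M_def algebra_simps)
  qed
  have pairs: "(\<forall>h\<in>V_pairs p. P (\<lambda>x. fst (h x)) (\<lambda>x. snd (h x)))
      \<longleftrightarrow> (\<forall>v\<in>V_space p. \<forall>H. has_weak_gradient p v H \<longrightarrow> P v H)" for P
  proof
    assume *: "\<forall>h\<in>V_pairs p. P (\<lambda>x. fst (h x)) (\<lambda>x. snd (h x))"
    show "\<forall>v\<in>V_space p. \<forall>H. has_weak_gradient p v H \<longrightarrow> P v H"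
    proof (intro ballI allI impI)
      fix v H assume "v \<in> V_space p" "has_weak_gradient p v H"
      then have "(\<lambda>x. (v x, H x)) \<in> V_pairs p" by (simp add: V_pairs_iff)
      from bspec[OF * this] show "P v H" by simp
    qed
  next
    assume *: "\<forall>v\<in>V_space p. \<forall>H. has_weak_gradient p v H \<longrightarrow> P v H"
    show "\<forall>h\<in>V_pairs p. P (\<lambda>x. fst (h x)) (\<lambda>x. snd (h x))"
    proof
      fix h assume "h \<in> V_pairs p"
      then show "P (\<lambda>x. fst (h x)) (\<lambda>x. snd (h x))"
        using * V_pairs_iff[of "\<lambda>x. fst (h x)" "\<lambda>x. snd (h x)" p] by simp
    qed
  qed
  have "bdf3_scheme_at p \<epsilon> t n (u(n := w)) \<longleftrightarrow>
    (\<exists>G. (\<lambda>x. (w x, G x)) \<in> V_pairs p \<and> (\<forall>h\<in>V_pairs p.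
      L2_inner (cell p) (D3 t n (u(n := w))) (\<lambda>x. fst (h x)) + \<epsilon>\<^sup>2 * L2_inner (cell p) G (\<lambda>x. snd (h x))
        + L2_inner (cell p) (\<lambda>x. ac_nonlinearity (w x)) (\<lambda>x. fst (h x)) = 0))"
    unfolding bdf3_scheme_at_def fun_upd_same
    by (subst pairs) (simp add: V_pairs_iff w)
  also have "\<dots> \<longleftrightarrow> (\<exists>G. (\<lambda>x. (w x, G x)) \<in> V_pairs p \<and> (\<forall>h\<in>V_pairs p.
      (\<integral>x. ((b - 1) * w x + w x ^ 3 - g x) * fst (h x) + \<epsilon>\<^sup>2 * (G x \<bullet> snd (h x)) \<partial>M) = 0))"
    using eq by (intro ex_cong1 conj_cong ball_cong refl) simp
  finally show ?thesis
    by (simp only: M_def b_def g_def)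
qed

theorem theorem4p1:
  fixes p :: "'d::finite \<Rightarrow> real ^ 'd"
    and \<epsilon> T :: real and t :: "nat \<Rightarrow> real" and N n :: nat
    and u :: "nat \<Rightarrow> real ^ 'd \<Rightarrow> real"
  assumes "period_basis p"
    and "\<epsilon> > 0"
    and "time_mesh N T t"
    and "1 \<le> n" and "n \<le> N"
    and "\<And>k. n - 3 \<le> k \<Longrightarrow> k < n \<Longrightarrow> u k \<in> V_space p"
    and "step t n <
      (1 + 2 * ratio t n + ratio t (n - 1) * (1 + 4 * ratio t n + 3 * (ratio t n)\<^sup>2)) /
      ((1 + ratio t n) * (1 + ratio t (n - 1) + ratio t n * ratio t (n - 1)))"
  shows "\<exists>w\<in>V_space p. bdf3_scheme_at p \<epsilon> t n (u(n := w)) \<and>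
    (\<forall>w'\<in>V_space p. bdf3_scheme_at p \<epsilon> t n (u(n := w')) \<longrightarrow> ae_eq_on (cell p) w' w)"
proof -
  define M where "M = lebesgue_on (cell p)"
  define g where "g = known_part t n u"
  define a where "a = bdf3_coeff t n 0 - 1"
  interpret finite_measure M
    unfolding M_def by (rule finite_measure_lebesgue_on[OF cell_lmeasurable])
  have "1 < bdf3_coeff t n 0"
    unfolding bdf3_leading_coeff[OF assms(3-5)]
    using assms(7) step_pos[OF assms(3-5)] by (subst less_divide_eq_1_pos)
  then have a: "0 < a" by (simp add: a_def)
  have e: "0 < \<epsilon>\<^sup>2" using assms(2) by simp
  have g: "square_integrable M g"
    unfolding g_def M_def using assms(4,6)
    by (intro known_part_square_integrable) (auto simp: V_space_def in_L2_iff)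
  note scheme = bdf3_scheme_iff[OF assms(4) g[unfolded g_def M_def],
      folded g_def M_def a_def]
  note K = V_pairs_finite_energy[where p = p, folded M_def] V_pairs_lincomb[where p = p]
  have "\<exists>f\<in>V_pairs p. \<forall>h\<in>V_pairs p.
      (\<integral>x. (a * fst (f x) + fst (f x) ^ 3 - g x) * fst (h x) + \<epsilon>\<^sup>2 * (snd (f x) \<bullet> snd (h x)) \<partial>M) = 0"
    by (rule energy_critical_point[OF a e g V_pairs_zero K V_pairs_closed[where p = p, folded M_def]])
  then obtain f where f: "f \<in> V_pairs p" and crit: "\<And>h. h \<in> V_pairs p \<Longrightarrow>
      (\<integral>x. (a * fst (f x) + fst (f x) ^ 3 - g x) * fst (h x) + \<epsilon>\<^sup>2 * (snd (f x) \<bullet> snd (h x)) \<partial>M) = 0"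
    by (elim bexE) simp
  define w where "w x = fst (f x)" for x
  have pair: "(\<lambda>x. (w x, snd (f x))) \<in> V_pairs p"
    using f by (simp add: w_def)
  then have w: "w \<in> V_space p"
    by (simp add: V_pairs_iff)
  show ?thesis
  proof (intro bexI[OF _ w] conjI ballI impI)
    show "bdf3_scheme_at p \<epsilon> t n (u(n := w))"
      unfolding scheme[OF w] using pair crit by (auto simp: w_def intro!: exI[of _ "\<lambda>x. snd (f x)"])
    fix w' assume w': "w' \<in> V_space p" and "bdf3_scheme_at p \<epsilon> t n (u(n := w'))"
    then obtain G' where f': "(\<lambda>x. (w' x, G' x)) \<in> V_pairs p" and crit': "\<And>h. h \<in> V_pairs p \<Longrightarrow>
        (\<integral>x. (a * w' x + w' x ^ 3 - g x) * fst (h x) + \<epsilon>\<^sup>2 * (G' x \<bullet> snd (h x)) \<partial>M) = 0"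
      unfolding scheme[OF w'] by blast
    have h: "(\<lambda>x. (w' x, G' x) - f x) \<in> V_pairs p"
      using K(2)[OF f' f, of "-1"] by simp
    have "AE x in M. fst (w' x, G' x) = fst (f x)"
      by (rule critical_point_unique[OF a e g K(1)[OF f] K(1)[OF f'] K(1)[OF h] crit[OF h]])
        (use crit'[OF h] in simp)
    then show "ae_eq_on (cell p) w' w"
      unfolding ae_eq_on_def w_def M_def[symmetric] by simp
  qed
qed

end
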